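(* Let $f:\mathbb{X}\to\mathbb{R}$ be a finite measurable function and $q$ a fixed integer. If $\limsup_n B_n^qf<+\infty$ $\mu$-a.e. on a set of positive measure, then there is $c\in\mathbb{R}\cup\{-\infty\}$ with $$\lim_n A_n^+f=\lim_n A_n^-f=\lim_n B_nf=\lim_n B_n^qf=c\quad\mu\text{-a.e. on }\mathbb{X}.$$ Moreover, a.e. convergence of $B_nf$ and a.e. convergence of $B_n^qf$ are equivalent.
   Context: Standing assumptions: $(\mathbb{X},\mathcal{X},\mu,T)$ is a probability space with $T$ an invertible, bi-measurable, measure-preserving, ergodic transformation. For measurable $f:\mathbb{X}\to\mathbb{R}$: $A_n^+f=\frac1n\sum_{i=0}^{n-1}f\circ T^i$, $A_n^-f=\frac1n\sum_{i=0}^{n-1}f\circ T^{-i}$, $B_nf=\frac{1}{2n+1}\sum_{i=-n}^{n}f\circ T^i$, and for a fixed integer $q$, the asymmetric bilateral averages $B_n^qf=\frac{1}{2n+1+q}\sum_{i=-n}^{n+q}f\circ T^i$ (defined for $n$ large enough that $2n+1+q>0$). *)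

theory Defs
  imports "HOL-Probability.Probability"
begin

definition inv_mpt :: "'a measure \<Rightarrow> ('a \<Rightarrow> 'a) \<Rightarrow> bool" where
  "inv_mpt M T \<longleftrightarrow>
     T \<in> M \<rightarrow>\<^sub>M M \<and> bij_betw T (space M) (space M) \<and>
     inv_into (space M) T \<in> M \<rightarrow>\<^sub>M M \<and>
     (\<forall>A\<in>sets M. emeasure M (T -` A \<inter> space M) = emeasure M A)"

definition ergodic :: "'a measure \<Rightarrow> ('a \<Rightarrow> 'a) \<Rightarrow> bool" where
  "ergodic M T \<longleftrightarrow>
     (\<forall>A\<in>sets M. T -` A \<inter> space M = A \<longrightarrow> emeasure M A = 0 \<or> emeasure M A = 1)"

definition Tpow :: "'a measure \<Rightarrow> ('a \<Rightarrow> 'a) \<Rightarrow> int \<Rightarrow> 'a \<Rightarrow> 'a" where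
  "Tpow M T i = (if 0 \<le> i then T ^^ nat i else inv_into (space M) T ^^ nat (- i))"

definition Aplus :: "'a measure \<Rightarrow> ('a \<Rightarrow> 'a) \<Rightarrow> ('a \<Rightarrow> real) \<Rightarrow> nat \<Rightarrow> 'a \<Rightarrow> real" where
  "Aplus M T f n x = (\<Sum>i<n. f (Tpow M T (int i) x)) / real n"

definition Aminus :: "'a measure \<Rightarrow> ('a \<Rightarrow> 'a) \<Rightarrow> ('a \<Rightarrow> real) \<Rightarrow> nat \<Rightarrow> 'a \<Rightarrow> real" where
  "Aminus M T f n x = (\<Sum>i<n. f (Tpow M T (- int i) x)) / real n"

definition Bavg :: "'a measure \<Rightarrow> ('a \<Rightarrow> 'a) \<Rightarrow> ('a \<Rightarrow> real) \<Rightarrow> nat \<Rightarrow> 'a \<Rightarrow> real" where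
  "Bavg M T f n x = (\<Sum>i\<in>{- int n .. int n}. f (Tpow M T i x)) / real (2 * n + 1)"

text \<open>Asymmetric bilateral averages B_n^q; only meaningful when 2n+1+q > 0,
  which holds for all large n (limits ignore the finitely many other n).\<close>
definition Bq :: "'a measure \<Rightarrow> ('a \<Rightarrow> 'a) \<Rightarrow> int \<Rightarrow> ('a \<Rightarrow> real) \<Rightarrow> nat \<Rightarrow> 'a \<Rightarrow> real" where
  "Bq M T q f n x = (\<Sum>i\<in>{- int n .. int n + q}. f (Tpow M T i x)) / (real (2 * n + 1) + of_int q)"

end

theory Submission
  imports Defs
begin

text \<open>
  Let F be the two-sided cocycle of f, so that the sum of f over the times in [a, b) is F b - F a.
  After subtracting a constant from f, the hypothesis on B_n^q says that F (k + p + n) \<le> F (k - n)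
  for all n \<ge> N, p = 1 + q, whenever the orbit is in some set of positive measure at time k: F does
  not increase under reflections, from left to right, about the return times k. Composing two
  such reflections bounds F on a set of times of density close to 1, and one more reflection
  bounds F on all n \<ge> 0. Reversing time, - F is bounded above on n \<le> 0.

  With m and l the suprema of these two half-orbits, g = m - m \<circ> T - f and k = l \<circ> T - l - f
  are nonnegative, and g - k is the coboundary of m + l. Since m + l is recurrent, Birkhoff's
  theorem gives g and k the same integral \<gamma> \<in> [0, \<infinity>], and
  - l - (sum of k) \<le> F \<le> m - (sum of g) squeezes both one-sided averages to - \<gamma>.
\<close>

section \<open>The ergodic theorem for nonnegative functions\<close>

definition orbit_sum :: "('a \<Rightarrow> 'a) \<Rightarrow> ('a \<Rightarrow> real) \<Rightarrow> nat \<Rightarrow> 'a \<Rightarrow> real" where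
  "orbit_sum T f n x = (\<Sum>i<n. f ((T ^^ i) x))"

lemma orbit_sum_0 [simp]: "orbit_sum T f 0 x = 0"
  by (simp add: orbit_sum_def)

lemma orbit_sum_Suc: "orbit_sum T f (Suc n) x = f x + orbit_sum T f n (T x)"
  by (simp add: orbit_sum_def sum.lessThan_Suc_shift funpow_swap1 del: sum.lessThan_Suc)

lemma orbit_sum_diff_const: "orbit_sum T (\<lambda>x. f x - c) n x = orbit_sum T f n x - c * real n"
  by (simp add: orbit_sum_def sum_subtractf)

text \<open>One-sided dynamics only: the locale is instantiated both for \<open>T\<close> and,
  through \<open>reverse\<close>, for its inverse.\<close>

locale ergodic_mpt = prob_space M for M :: "'a measure" +
  fixes T :: "'a \<Rightarrow> 'a"
  assumes T_measurable [measurable]: "T \<in> M \<rightarrow>\<^sub>M M"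
    and distr_T: "distr M M T = M"
    and ergodic_T: "\<And>A. A \<in> sets M \<Longrightarrow> T -` A \<inter> space M = A \<Longrightarrow> prob A = 0 \<or> prob A = 1"
begin

lemma funpow_measurable [measurable]: "T ^^ n \<in> M \<rightarrow>\<^sub>M M"
  by (induction n) auto

lemma orbit_sum_measurable [measurable]:
  assumes [measurable]: "f \<in> borel_measurable M"
  shows "orbit_sum T f n \<in> borel_measurable M"
  unfolding orbit_sum_def by measurable

lemma T_space: "x \<in> space M \<Longrightarrow> T x \<in> space M"
  using measurable_space[OF T_measurable] .

lemma AE_T: "AE x in M. P x \<Longrightarrow> AE x in M. P (T x)"
  by (rule AE_distrD[OF T_measurable]) (unfold distr_T)

lemma integrable_T:
  fixes f :: "'a \<Rightarrow> real"
  shows "integrable M f \<Longrightarrow> integrable M (\<lambda>x. f (T x))"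
  using integrable_distr[OF T_measurable, of f] by (simp add: distr_T)

lemma integral_T:
  fixes f :: "'a \<Rightarrow> real"
  shows "f \<in> borel_measurable M \<Longrightarrow> (\<integral>x. f (T x) \<partial>M) = (\<integral>x. f x \<partial>M)"
  using integral_distr[OF T_measurable, of f] by (simp add: distr_T)

lemma nn_integral_T:
  "f \<in> borel_measurable M \<Longrightarrow> (\<integral>\<^sup>+x. f (T x) \<partial>M) = (\<integral>\<^sup>+x. f x \<partial>M)"
  using nn_integral_distr[OF T_measurable, of f] by (simp add: distr_T)

section \<open>The maximal ergodic inequality\<close>

text \<open>The maximum of the orbit sums of lengths 0 to N. The recursion, which reflects
  \<open>orbit_sum_Suc\<close>, makes the maximal inequality a one-step computation.\<close>

primrec max_sum :: "('a \<Rightarrow> real) \<Rightarrow> nat \<Rightarrow> 'a \<Rightarrow> real" where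
  "max_sum f 0 x = 0"
| "max_sum f (Suc N) x = max 0 (f x + max_sum f N (T x))"

lemma max_sum_nonneg: "0 \<le> max_sum f N x"
  by (cases N) auto

lemma max_sum_mono: "max_sum f N x \<le> max_sum f (Suc N) x"
proof (induction N arbitrary: x)
  case (Suc N)
  have "f x + max_sum f N (T x) \<le> f x + max_sum f (Suc N) (T x)"
    using Suc[of "T x"] by (rule add_left_mono)
  then show ?case
    unfolding max_sum.simps(2)[of f N x] max_sum.simps(2)[of f "Suc N" x] by (rule max.mono[OF order_refl])
qed simp

lemma orbit_sum_le_max_sum: "orbit_sum T f n x \<le> max_sum f n x"
proof (induction n arbitrary: x)
  case (Suc n)
  from Suc[of "T x"] show ?case by (simp add: orbit_sum_Suc)
qed simp

lemma integrable_max_sum: "integrable M f \<Longrightarrow> integrable M (max_sum f N)"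
proof (induction N)
  case 0
  then show ?case by simp
next
  case (Suc N)
  then have "integrable M (\<lambda>x. max 0 (f x + max_sum f N (T x)))"
    using integrable_max[OF integrable_zero Bochner_Integration.integrable_add[OF Suc.prems integrable_T[OF Suc.IH]]]
    by simp
  then show ?case unfolding max_sum.simps .
qed

text \<open>Garsia's argument: where \<open>max_sum f (Suc N)\<close> is positive, f is exactly
  \<open>max_sum f (Suc N) x - max_sum f N (T x)\<close>, and elsewhere this difference is at most
  0. Its integral is nonnegative because T preserves integrals and \<open>max_sum\<close> increases
  in N.\<close>

lemma maximal_ergodic:
  assumes f: "integrable M f"
  shows "0 \<le> (\<integral>x. indicator {x. max_sum f (Suc N) x > 0} x * f x \<partial>M)"
proof -
  note [measurable] = borel_measurable_integrable[OF f] borel_measurable_integrable[OF integrable_max_sum[OF f]]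
  let ?E = "{x. max_sum f (Suc N) x > 0}"
  have i1: "integrable M (\<lambda>x. indicator ?E x * f x)"
    by (rule Bochner_Integration.integrable_bound[OF f]) (auto simp: indicator_def)
  have "0 \<le> (\<integral>x. max_sum f (Suc N) x \<partial>M) - (\<integral>x. max_sum f N x \<partial>M)"
    using integral_mono[OF integrable_max_sum[OF f] integrable_max_sum[OF f] max_sum_mono] by simp
  also have "\<dots> = (\<integral>x. max_sum f (Suc N) x \<partial>M) - (\<integral>x. max_sum f N (T x) \<partial>M)"
    by (simp add: integral_T)
  also have "\<dots> = (\<integral>x. max_sum f (Suc N) x - max_sum f N (T x) \<partial>M)"
    by (rule Bochner_Integration.integral_diff[symmetric, OF integrable_max_sum[OF f] integrable_T[OF integrable_max_sum[OF f]]])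
  also have "\<dots> \<le> (\<integral>x. indicator ?E x * f x \<partial>M)"
  proof (rule integral_mono[OF _ i1])
    show "integrable M (\<lambda>x. max_sum f (Suc N) x - max_sum f N (T x))"
      by (rule Bochner_Integration.integrable_diff[OF integrable_max_sum[OF f] integrable_T[OF integrable_max_sum[OF f]]])
  next
    fix x show "max_sum f (Suc N) x - max_sum f N (T x) \<le> indicator ?E x * f x"
      using max_sum_nonneg[of f N "T x"] by (auto simp: indicator_def)
  qed
  finally show ?thesis .
qed

text \<open>The set where the sums are unbounded is invariant; if it had full measure, the maximal
  inequality would hold on the whole space in the limit.\<close>
lemma AE_bdd_above_orbit_sum:
  assumes f: "integrable M f" and neg: "(\<integral>x. f x \<partial>M) < 0"
  shows "AE x in M. \<exists>B. \<forall>n. orbit_sum T f n x \<le> B"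
proof -
  note [measurable] = borel_measurable_integrable[OF f] borel_measurable_integrable[OF integrable_max_sum[OF f]]
  define I where "I = {x\<in>space M. \<forall>K::nat. \<exists>n. orbit_sum T f n x > real K}"
  have I [measurable]: "I \<in> sets M" unfolding I_def by measurable
  \<comment> \<open>The condition on b excludes the empty sum n = 0 on the right, so that one step
    of the orbit can be removed. Below, \<open>max\<close> raises the thresholds to meet this
    condition.\<close>
  have shift: "(\<exists>n. orbit_sum T f n (T x) > b) \<longleftrightarrow> (\<exists>n. orbit_sum T f n x > b + f x)"
    if "b + f x \<ge> 0" for b x
  proof
    assume "\<exists>n. orbit_sum T f n (T x) > b"
    then obtain n where "orbit_sum T f n (T x) > b" ..
    then have "orbit_sum T f (Suc n) x > b + f x" by (simp add: orbit_sum_Suc)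
    then show "\<exists>n. orbit_sum T f n x > b + f x" ..
  next
    assume "\<exists>n. orbit_sum T f n x > b + f x"
    then obtain n where n: "orbit_sum T f n x > b + f x" ..
    with that obtain m where "n = Suc m" by (cases n) auto
    with n show "\<exists>n. orbit_sum T f n (T x) > b" by (auto simp: orbit_sum_Suc)
  qed
  \<comment> \<open>Natural thresholds make I visibly measurable; real ones absorb the shift by
    \<open>f x\<close>.\<close>
  have unb: "(\<forall>K::nat. \<exists>n. orbit_sum T f n x > real K) \<longleftrightarrow> (\<forall>b. \<exists>n. orbit_sum T f n x > b)" for x
    by (meson less_trans reals_Archimedean2)
  have inv: "T -` I \<inter> space M = I"
  proof -
    have "(\<forall>b. \<exists>n. orbit_sum T f n (T x) > b) \<longleftrightarrow> (\<forall>b. \<exists>n. orbit_sum T f n x > b)" for x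
    proof safe
      fix b assume *: "\<forall>b. \<exists>n. orbit_sum T f n (T x) > b"
      have "\<exists>n. orbit_sum T f n x > max (b - f x) (- f x) + f x"
        using spec[OF *, of "max (b - f x) (- f x)"] shift[of "max (b - f x) (- f x)" x]
        by (simp only: max_def split: if_splits) auto
      then obtain n where "max (b - f x) (- f x) + f x < orbit_sum T f n x" ..
      then have "b < orbit_sum T f n x" by linarith
      then show "\<exists>n. orbit_sum T f n x > b" ..
    next
      fix b assume *: "\<forall>b. \<exists>n. orbit_sum T f n x > b"
      have "\<exists>n. orbit_sum T f n (T x) > max b (- f x)"
        using spec[OF *, of "max b (- f x) + f x"] shift[of "max b (- f x)" x]
        by (simp only: max_def split: if_splits) auto
      then show "\<exists>n. orbit_sum T f n (T x) > b" by auto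
    qed
    then show ?thesis unfolding I_def unb by (auto simp: T_space)
  qed
  have "prob I \<noteq> 1"
  proof
    assume "prob I = 1"
    then have AE_I: "AE x in M. x \<in> I" using prob_eq_1[OF I] by simp
    have "(\<lambda>N. \<integral>x. indicator {x. max_sum f (Suc N) x > 0} x * f x \<partial>M) \<longlonglongrightarrow> (\<integral>x. f x \<partial>M)"
    proof (rule integral_dominated_convergence[where w = "\<lambda>x. \<bar>f x\<bar>"])
      show "AE x in M. (\<lambda>N. indicator {x. max_sum f (Suc N) x > 0} x * f x) \<longlonglongrightarrow> f x"
        using AE_I
      proof eventually_elim
        fix x assume "x \<in> I"
        then obtain n where n: "orbit_sum T f n x > 0" by (auto simp: I_def dest: spec[of _ 0])
        have "0 < max_sum f (Suc N) x" if "N \<ge> n" for N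
        proof -
          have "max_sum f n x \<le> max_sum f (Suc N) x"
            by (rule lift_Suc_mono_le[of "\<lambda>n. max_sum f n x"]) (use that max_sum_mono in auto)
          with n orbit_sum_le_max_sum[of f n x] show ?thesis by simp
        qed
        then have "eventually (\<lambda>N. indicator {x. max_sum f (Suc N) x > 0} x * f x = f x) sequentially"
          by (auto simp: eventually_sequentially indicator_def simp del: max_sum.simps)
        then show "(\<lambda>N. indicator {x. max_sum f (Suc N) x > 0} x * f x) \<longlonglongrightarrow> f x"
          by (rule tendsto_eventually)
      qed
    qed (use f in \<open>auto simp: indicator_def\<close>)
    then have "0 \<le> (\<integral>x. f x \<partial>M)"
      by (rule LIMSEQ_le_const) (use maximal_ergodic[OF f] in blast)
    with neg show False by simp
  qed
  with ergodic_T[OF I inv] have "AE x in M. x \<notin> I" by (simp add: prob_eq_0)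
  with AE_space show ?thesis
    by eventually_elim (auto simp: I_def not_less)
qed

text \<open>The function f - c has negative integral, so its orbit sums are bounded above. This
  linear bound is the upper half of Birkhoff's theorem; applied to - f it gives the lower
  half.\<close>

lemma AE_orbit_sum_le:
  assumes f: "integrable M f" and c: "(\<integral>x. f x \<partial>M) < c"
  shows "AE x in M. \<exists>B. \<forall>n. orbit_sum T f n x \<le> c * real n + B"
proof -
  have "AE x in M. \<exists>B. \<forall>n. orbit_sum T (\<lambda>x. f x - c) n x \<le> B"
    using assms by (intro AE_bdd_above_orbit_sum) (auto simp: prob_space)
  then show ?thesis
    by eventually_elim (auto simp: orbit_sum_diff_const algebra_simps)
qed

lemma AE_orbit_sum_ge:
  assumes f: "integrable M f" and c: "c < (\<integral>x. f x \<partial>M)"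
  shows "AE x in M. \<exists>B. \<forall>n. c * real n - B \<le> orbit_sum T f n x"
proof -
  have "AE x in M. \<exists>B. \<forall>n. orbit_sum T (\<lambda>x. - f x) n x \<le> (- c) * real n + B"
    by (rule AE_orbit_sum_le) (use assms in auto)
  then show ?thesis
    by eventually_elim (auto simp: orbit_sum_def sum_negf algebra_simps)
qed

end

section \<open>Birkhoff averages with a possibly infinite limit\<close>

lemma eventually_div_less_if_le:
  fixes u :: "nat \<Rightarrow> real"
  assumes "\<And>n. u n \<le> r * real n + B" "r < s"
  shows "eventually (\<lambda>n. u n / real n < s) sequentially"
proof -
  obtain N where N: "B / (s - r) < real N" using reals_Archimedean2 by blast
  show ?thesis unfolding eventually_sequentially
  proof (intro exI allI impI)
    fix n assume n: "n \<ge> Suc N"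
    then have "B / (s - r) < real n" using N by simp
    then have "B < (s - r) * real n" using \<open>r < s\<close> by (simp add: field_simps)
    then have "u n < s * real n" using assms(1)[of n] by (simp add: algebra_simps)
    with n show "u n / real n < s" by (simp add: divide_less_eq)
  qed
qed

lemma eventually_div_greater_if_ge:
  fixes u :: "nat \<Rightarrow> real"
  assumes "\<And>n. r * real n - B \<le> u n" "s < r"
  shows "eventually (\<lambda>n. s < u n / real n) sequentially"
proof -
  have *: "\<And>n. - u n \<le> (- r) * real n + B" using assms(1) by (simp add: algebra_simps)
  show ?thesis
    using eventually_div_less_if_le[OF *, of "- s"] assms(2) by simp
qed

text \<open>Rational thresholds are countable, so the exceptional null sets of the separate bounds
  can be united.\<close>

lemma tendsto_ereal_if_rational_bounds:
  fixes u :: "nat \<Rightarrow> real" and \<gamma> :: ereal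
  assumes up: "\<And>r::rat. \<gamma> < ereal (of_rat r) \<Longrightarrow> eventually (\<lambda>n. u n < of_rat r) F"
    and lo: "\<And>r::rat. ereal (of_rat r) < \<gamma> \<Longrightarrow> eventually (\<lambda>n. of_rat r < u n) F"
  shows "((\<lambda>n. ereal (u n)) \<longlongrightarrow> \<gamma>) F"
proof (rule order_tendstoI)
  fix a :: ereal assume "a < \<gamma>"
  then obtain r where r: "a < ereal (of_rat r)" "ereal (of_rat r) < \<gamma>"
    using ereal_dense3 by blast
  show "eventually (\<lambda>n. a < ereal (u n)) F"
    using lo[OF r(2)] by eventually_elim (rule less_trans[OF r(1)], simp)
next
  fix a :: ereal assume "\<gamma> < a"
  then obtain r where r: "\<gamma> < ereal (of_rat r)" "ereal (of_rat r) < a"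
    using ereal_dense3 by blast
  show "eventually (\<lambda>n. ereal (u n) < a) F"
    using up[OF r(1)] by eventually_elim (rule less_trans[OF _ r(2)], simp)
qed

context ergodic_mpt
begin

text \<open>A rational strictly above the integral exists only if the integral is finite, and then g
  is integrable. Lower bounds come from the truncations \<open>min (g x) (real k)\<close>, whose
  integrals increase to that of g by monotone convergence.\<close>

lemma birkhoff_nonneg:
  assumes g [measurable]: "g \<in> borel_measurable M" and nonneg: "\<And>x. 0 \<le> g x"
  shows "AE x in M. (\<lambda>n. ereal (orbit_sum T g n x / real n))
    \<longlonglongrightarrow> enn2ereal (\<integral>\<^sup>+x. ennreal (g x) \<partial>M)"
proof -
  define \<gamma> where "\<gamma> = enn2ereal (\<integral>\<^sup>+x. ennreal (g x) \<partial>M)"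
  have up: "AE x in M. eventually (\<lambda>n. orbit_sum T g n x / real n < of_rat r) sequentially"
    if r: "\<gamma> < ereal (of_rat r)" for r
  proof -
    have "(\<integral>\<^sup>+x. ennreal (g x) \<partial>M) < \<infinity>"
      using r unfolding \<gamma>_def by (cases "\<integral>\<^sup>+x. ennreal (g x) \<partial>M") auto
    then have int: "integrable M g"
      by (intro integrableI_nonneg) (auto simp: nonneg)
    then have "\<gamma> = ereal (\<integral>x. g x \<partial>M)"
      unfolding \<gamma>_def by (subst nn_integral_eq_integral) (auto simp: nonneg enn2ereal_ennreal)
    with r have "(\<integral>x. g x \<partial>M) < of_rat r" by simp
    then obtain s where s: "(\<integral>x. g x \<partial>M) < s" "s < of_rat r" using dense by blast
    show ?thesis using AE_orbit_sum_le[OF int s(1)]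
      by eventually_elim (elim exE, rule eventually_div_less_if_le[OF _ s(2)], blast)
  qed
  have lo: "AE x in M. eventually (\<lambda>n. of_rat r < orbit_sum T g n x / real n) sequentially"
    if r: "ereal (of_rat r) < \<gamma>" for r
  proof -
    have int: "integrable M (\<lambda>x. min (g x) (real k))" for k
      by (rule integrable_const_bound[where B = "real k"]) (auto simp: nonneg)
    have sup: "(SUP k. ennreal (min (g x) (real k))) = ennreal (g x)" for x
    proof (rule antisym)
      obtain k where "g x \<le> real k" using real_arch_simple by blast
      then show "ennreal (g x) \<le> (SUP k. ennreal (min (g x) (real k)))"
        by (intro SUP_upper2[of k]) auto
    qed (auto intro!: SUP_least ennreal_leI)
    have "(\<integral>\<^sup>+x. ennreal (g x) \<partial>M) = (\<integral>\<^sup>+x. (SUP k. ennreal (min (g x) (real k))) \<partial>M)"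
      by (simp add: sup)
    also have "\<dots> = (SUP k. \<integral>\<^sup>+x. ennreal (min (g x) (real k)) \<partial>M)"
      by (rule nn_integral_monotone_convergence_SUP) (auto simp: incseq_def le_fun_def intro!: ennreal_leI)
    also have "\<dots> = (SUP k. ennreal (\<integral>x. min (g x) (real k) \<partial>M))"
      by (subst nn_integral_eq_integral[OF int]) (auto simp: nonneg)
    finally have \<gamma>: "\<gamma> = enn2ereal (SUP k. ennreal (\<integral>x. min (g x) (real k) \<partial>M))"
      by (simp add: \<gamma>_def)
    \<comment> \<open>For r < 0 any truncation works; this case is separated because
      \<open>ennreal\<close> sends negative numbers to 0.\<close>
    obtain k where k: "of_rat r < (\<integral>x. min (g x) (real k) \<partial>M)"
    proof (cases "of_rat r < (0::real)")
      case True
      have "(0::real) \<le> (\<integral>x. min (g x) (real 0) \<partial>M)" by (rule Bochner_Integration.integral_nonneg) (auto simp: nonneg)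
      with True that show thesis by (meson less_le_trans)
    next
      case False
      then have e: "ereal (of_rat r) = enn2ereal (ennreal (of_rat r))" by (simp add: enn2ereal_ennreal)
      then have "ennreal (of_rat r) < (SUP k. ennreal (\<integral>x. min (g x) (real k) \<partial>M))"
        using r unfolding \<gamma> less_ennreal.rep_eq by (subst e[symmetric])
      then obtain k where "ennreal (of_rat r) < ennreal (\<integral>x. min (g x) (real k) \<partial>M)"
        by (auto simp: less_SUP_iff)
      with False that show thesis by (auto simp: ennreal_less_iff)
    qed
    then obtain s where s: "of_rat r < s" "s < (\<integral>x. min (g x) (real k) \<partial>M)" using dense by blast
    have le: "orbit_sum T (\<lambda>x. min (g x) (real k)) n x \<le> orbit_sum T g n x" for n x
      unfolding orbit_sum_def by (rule sum_mono) auto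
    show ?thesis using AE_orbit_sum_ge[OF int s(2)]
    proof eventually_elim
      fix x assume "\<exists>B. \<forall>n. s * real n - B \<le> orbit_sum T (\<lambda>x. min (g x) (real k)) n x"
      then obtain B where "\<And>n. s * real n - B \<le> orbit_sum T g n x" using le by (meson order_trans)
      from eventually_div_greater_if_ge[OF this s(1)]
      show "eventually (\<lambda>n. of_rat r < orbit_sum T g n x / real n) sequentially" .
    qed
  qed
  have "AE x in M. \<forall>r::rat. (\<gamma> < ereal (of_rat r) \<longrightarrow> eventually (\<lambda>n. orbit_sum T g n x / real n < of_rat r) sequentially)
     \<and> (ereal (of_rat r) < \<gamma> \<longrightarrow> eventually (\<lambda>n. of_rat r < orbit_sum T g n x / real n) sequentially)"
    unfolding AE_all_countable using up lo by auto
  then show ?thesis unfolding \<gamma>_def[symmetric]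
    by eventually_elim (rule tendsto_ereal_if_rational_bounds, auto)
qed

section \<open>Visit frequencies and recurrence\<close>

lemma visit_frequency:
  assumes [measurable]: "A \<in> sets M"
  shows "AE x in M. (\<lambda>n. orbit_sum T (indicator A) n x / real n) \<longlonglongrightarrow> prob A"
proof -
  have "AE x in M. (\<lambda>n. ereal (orbit_sum T (indicator A) n x / real n))
    \<longlonglongrightarrow> enn2ereal (\<integral>\<^sup>+x. ennreal (indicator A x) \<partial>M)"
    by (rule birkhoff_nonneg) auto
  moreover have "enn2ereal (\<integral>\<^sup>+x. ennreal (indicator A x) \<partial>M) = ereal (prob A)"
    by (simp add: ennreal_indicator emeasure_eq_measure enn2ereal_ennreal)
  ultimately show ?thesis by simp
qed

text \<open>If all visits happened before time N, their number would stay at most N and their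
  frequency would tend to 0 instead of \<open>prob A\<close>.\<close>

lemma visits_infinitely_often:
  assumes A: "A \<in> sets M" and pos: "prob A > 0"
  shows "AE x in M. \<forall>N. \<exists>n\<ge>N. (T ^^ n) x \<in> A"
  using visit_frequency[OF A]
proof eventually_elim
  fix x assume lim: "(\<lambda>n. orbit_sum T (indicator A) n x / real n) \<longlonglongrightarrow> prob A"
  show "\<forall>N. \<exists>n\<ge>N. (T ^^ n) x \<in> A"
  proof (rule ccontr)
    assume "\<not> (\<forall>N. \<exists>n\<ge>N. (T ^^ n) x \<in> A)"
    then obtain N where N: "\<And>n. n \<ge> N \<Longrightarrow> (T ^^ n) x \<notin> A" by blast
    have "orbit_sum T (indicator A) n x \<le> real N" for n
    proof -
      have "orbit_sum T (indicator A) n x = (\<Sum>i\<in>{..<n} \<inter> {..<N}. indicator A ((T ^^ i) x))"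
        unfolding orbit_sum_def by (rule sum.mono_neutral_right) (use N in \<open>auto simp: indicator_def simp flip: not_le\<close>)
      also have "\<dots> \<le> (\<Sum>i\<in>{..<n} \<inter> {..<N}. 1)" by (rule sum_mono) (auto simp: indicator_def)
      also have "\<dots> \<le> real (card {..<N})" by (simp del: card_lessThan add: card_mono)
      finally show ?thesis by simp
    qed
    then have "eventually (\<lambda>n. orbit_sum T (indicator A) n x / real n < prob A / 2) sequentially"
      using eventually_div_less_if_le[of "\<lambda>n. orbit_sum T (indicator A) n x" 0 "real N" "prob A / 2"] pos by simp
    moreover have "eventually (\<lambda>n. orbit_sum T (indicator A) n x / real n > prob A / 2) sequentially"
      using order_tendstoD(1)[OF lim, of "prob A / 2"] pos by simp
    ultimately have "eventually (\<lambda>n. False) sequentially" by eventually_elim simp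
    then show False by simp
  qed
qed

end

section \<open>Reflections\<close>

text \<open>Restates a density as a count with linear error over integer intervals, so that counts
  can be combined by linear arithmetic.\<close>

lemma density_bound:
  fixes R :: "int set" and \<alpha> \<delta> :: real
  assumes lim: "(\<lambda>n. (\<Sum>i<n. indicator R (int i)) / real n) \<longlonglongrightarrow> \<alpha>" and "\<delta> > 0"
  obtains m where "m > 0"
    "\<And>z. z \<ge> m \<Longrightarrow> \<bar>(\<Sum>l\<in>{0..<z}. indicator R l) - \<alpha> * real_of_int z\<bar> \<le> \<delta> * real_of_int z"
proof -
  obtain n0 where n0: "\<And>n. n \<ge> n0 \<Longrightarrow> \<bar>(\<Sum>i<n. indicator R (int i)) / real n - \<alpha>\<bar> < \<delta>"
    using LIMSEQ_D[OF lim \<open>\<delta> > 0\<close>] by (auto simp: real_norm_def)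
  show thesis
  proof
    show "int n0 + 1 > 0" by simp
    fix z :: int assume z: "z \<ge> int n0 + 1"
    then obtain n where n: "z = int n" by (metis of_nat_0_le_iff add_increasing2 order_trans zero_le_one nonneg_int_cases)
    have "(\<Sum>l\<in>{0..<z}. indicator R l :: real) = (\<Sum>i<n. indicator R (int i))"
      by (rule sum.reindex_bij_witness[of _ int nat]) (auto simp: n)
    moreover have "\<bar>(\<Sum>i<n. indicator R (int i)) / real n - \<alpha>\<bar> * real n \<le> \<delta> * real n"
      using n0[of n] z n by (intro mult_right_mono) auto
    moreover have "\<bar>(\<Sum>i<n. indicator R (int i)) / real n - \<alpha>\<bar> * real n
        = \<bar>((\<Sum>i<n. indicator R (int i)) / real n - \<alpha>) * real n\<bar>" by (simp add: abs_mult)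
    moreover have "((\<Sum>i<n. indicator R (int i)) / real n - \<alpha>) * real n = (\<Sum>i<n. indicator R (int i)) - \<alpha> * real n"
      using z n by (simp add: field_simps)
    ultimately show "\<bar>(\<Sum>l\<in>{0..<z}. indicator R l) - \<alpha> * real_of_int z\<bar> \<le> \<delta> * real_of_int z"
      using n by simp
  qed
qed

text \<open>The hypothesis says that F m is at most F at the mirror point 2 k + p - m, for m far
  enough to the right of k. Two reflections compose to an even translation, which carries the bound
  on a finite window to all late times whose halves, up to a shift, lie in R'. Since R is denser
  than the complement of R', a third reflection takes any late time to one of these.\<close>

lemma bounded_by_reflections:
  fixes F :: "int \<Rightarrow> real" and R :: "int set" and p N :: int and J :: nat and \<alpha> \<rho> :: real
  defines "R' \<equiv> {m. \<exists>i\<le>J. m - int i \<in> R}"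
  assumes refl: "\<And>k n. k \<in> R \<Longrightarrow> n \<ge> N \<Longrightarrow> F (k + p + n) \<le> F (k - n)"
    and R: "(\<lambda>n. (\<Sum>i<n. indicator R (int i)) / real n) \<longlonglongrightarrow> \<alpha>"
    and R': "(\<lambda>n. (\<Sum>i<n. indicator R' (int i)) / real n) \<longlonglongrightarrow> \<rho>"
    and dens: "1 - \<rho> < \<alpha>"
    and unb: "\<And>b. \<exists>k\<in>R. k \<ge> b"
  shows "\<exists>B. \<forall>n\<ge>0. F n \<le> B"
proof -
  \<comment> \<open>\<open>k0\<close> lies so far right that every j of the window
    \<open>{0..2 * int J + 1}\<close> can be reflected about it; beyond \<open>l0\<close> every l of
    R can serve for the second reflection. The window allows for delays i up to J and both parities
    of m.\<close>
  obtain k0 where k0: "k0 \<in> R" "k0 \<ge> N + (2 * int J + 1)" using unb by blast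
  define l0 where "l0 = 2 * \<bar>k0\<bar> + \<bar>p\<bar> + \<bar>N\<bar>"
  define C where "C = Max (F ` {0..2 * int J + 1})"
  \<comment> \<open>Reflecting j about k0 and then about l gives j + 2 (l - k0).\<close>
  have low: "F m \<le> C" if "m div 2 + k0 \<in> R'" "m div 2 + k0 \<ge> l0 + int J" for m
  proof -
    from that(1) obtain i where i: "i \<le> J" "m div 2 + k0 - int i \<in> R" by (auto simp: R'_def)
    define l where "l = m div 2 + k0 - int i"
    define j where "j = m - 2 * (l - k0)"
    have j: "0 \<le> j" "j \<le> 2 * int J + 1" unfolding j_def l_def using i(1) by auto
    have "F (k0 + p + (k0 - j)) \<le> F (k0 - (k0 - j))"
      by (rule refl) (use k0 j in auto)
    moreover have "F (l + p + (l - (2 * k0 + p - j))) \<le> F (l - (l - (2 * k0 + p - j)))"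
      by (rule refl) (use i that(2) j in \<open>auto simp: l_def l0_def\<close>)
    moreover have "l + p + (l - (2 * k0 + p - j)) = m" by (simp add: j_def)
    moreover have "k0 + p + (k0 - j) = l - (l - (2 * k0 + p - j))" by simp
    ultimately have "F m \<le> F j" by simp
    also have "\<dots> \<le> C" unfolding C_def using j by (intro Max_ge) auto
    finally show ?thesis .
  qed
  \<comment> \<open>The margin in \<open>dens\<close>. With tolerance \<eta> / 8 the three counting
    errors together cost about \<eta> n / 4, against a main term of about \<eta> n / 2.\<close>
  define \<eta> where "\<eta> = \<alpha> - 1 + \<rho>"
  have \<eta>: "\<eta> > 0" using dens by (simp add: \<eta>_def)
  obtain m1 where m1: "m1 > 0" "\<And>z. z \<ge> m1 \<Longrightarrow> \<bar>(\<Sum>l\<in>{0..<z}. indicator R l) - \<alpha> * real_of_int z\<bar> \<le> \<eta> / 8 * real_of_int z"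
    using density_bound[OF R, of "\<eta> / 8"] \<eta> by auto
  obtain m2 where m2: "m2 > 0" "\<And>z. z \<ge> m2 \<Longrightarrow> \<bar>(\<Sum>l\<in>{0..<z}. indicator R' l) - \<rho> * real_of_int z\<bar> \<le> \<eta> / 8 * real_of_int z"
    using density_bound[OF R', of "\<eta> / 8"] \<eta> by auto
  \<comment> \<open>One constant for all bounded offsets: below, a - e, b - n and e - n / 2 have
    absolute value at most c. The choice of \<open>n1\<close> makes \<eta> n exceed all terms that
    do not grow with n.\<close>
  define c where "c = l0 + int J + \<bar>k0\<bar> + \<bar>p\<bar> + \<bar>N\<bar> + m1 + m2 + 2"
  have c: "c > 0" using m1 m2 by (simp add: c_def l0_def)
  obtain n1 :: nat where n1: "(10 * \<eta> + 4 * \<bar>\<alpha>\<bar> + 4) * of_int c / \<eta> < real n1" using reals_Archimedean2 by blast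
  have large: "F n \<le> C" if n: "n \<ge> 8 * c" "n \<ge> int n1" for n
  proof (rule ccontr)
    assume nle: "\<not> F n \<le> C"
    \<comment> \<open>F n is bounded by its value at 2 l + p - n for every l \<in> R with a \<le> l < b. If none of
      these values were at most C, then R would have density at most 1 - \<rho> in [a, b).\<close>
    define h where "h = (p - n) div 2"
    define e where "e = - h - k0"
    define a where "a = e + l0 + int J"
    define b where "b = n - p - N + 1"
    have "2 * h \<le> p - n" "p - n - 1 \<le> 2 * h" unfolding h_def by auto
    moreover have "\<bar>k0\<bar> + \<bar>p\<bar> + 1 \<le> c" using m1 m2 by (simp add: c_def l0_def)
    ultimately have e: "2 * e \<le> n + 2 * c" "2 * e \<ge> n - 2 * c"
      unfolding e_def using m1(1) m2(1) by (simp_all add: abs_if split: if_splits)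
    have a: "a \<le> e + c" "a \<ge> e" "a \<ge> 0" using m1 m2 e n c by (auto simp: a_def c_def l0_def)
    have b: "b \<le> n + c" "b \<ge> n - c" using m1 m2 by (auto simp: b_def c_def l0_def)
    have ab: "a \<le> b" "e \<ge> 0" "b - e \<ge> c" "a \<ge> c" using a b e n c by - linarith+
    have cm: "c \<ge> m1" "c \<ge> m2" using m1 m2 by (auto simp: c_def l0_def)
    have miss: "l - e \<notin> R'" if l: "l \<in> R" "a \<le> l" "l < b" for l
    proof
      assume l': "l - e \<in> R'"
      have "2 * l + p - n = (p - n) + l * 2" by simp
      then have "(2 * l + p - n) div 2 + k0 = l - e" unfolding e_def h_def by (simp only: div_mult_self1[OF zero_neq_numeral[symmetric]])
      then have "F (2 * l + p - n) \<le> C" using low[of "2 * l + p - n"] l l' by (simp add: a_def)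
      moreover have "F (l + p + (n - p - l)) \<le> F (l - (n - p - l))"
        by (rule refl) (use l in \<open>auto simp: b_def\<close>)
      moreover have "l - (n - p - l) = 2 * l + p - n" by simp
      ultimately show False using nle by simp
    qed
    \<comment> \<open>The count of R in [a, b) is a difference of counts from 0, which
      \<open>m1\<close> controls. By \<open>miss\<close> and a translation by e, it is at most the
      number of times in [0, b - e) outside R', which \<open>m2\<close> controls.\<close>
    have "(\<Sum>l\<in>{0..<b}. indicator R l :: real) = (\<Sum>l\<in>{0..<a}. indicator R l) + (\<Sum>l\<in>{a..<b}. indicator R l)"
      using ab(1) a(3) by (subst sum.union_disjoint[symmetric]) (auto simp: ivl_disj_un intro!: sum.cong)
    moreover have "(\<Sum>l\<in>{a..<b}. indicator R l :: real) \<le> (\<Sum>l\<in>{a..<b}. 1 - indicator R' (l - e))"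
      by (rule sum_mono) (use miss in \<open>auto simp: indicator_def\<close>)
    moreover have "(\<Sum>l\<in>{a..<b}. 1 - indicator R' (l - e) :: real) \<le> (\<Sum>l\<in>{e..<b}. 1 - indicator R' (l - e))"
      by (rule sum_mono2) (use a in \<open>auto simp: indicator_def\<close>)
    moreover have "(\<Sum>l\<in>{e..<b}. 1 - indicator R' (l - e) :: real) = (\<Sum>l\<in>{0..<b - e}. 1 - indicator R' l)"
      by (rule sum.reindex_bij_witness[of _ "\<lambda>l. l + e" "\<lambda>l. l - e"]) auto
    moreover have "(\<Sum>l\<in>{0..<b - e}. 1 - indicator R' l :: real) = of_int (b - e) - (\<Sum>l\<in>{0..<b - e}. indicator R' l)"
      using ab c by (simp add: sum_subtractf)
    moreover have "\<bar>(\<Sum>l\<in>{0..<a}. indicator R l) - \<alpha> * real_of_int a\<bar> \<le> \<eta> / 8 * real_of_int a"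
      by (rule m1(2)) (use ab cm in auto)
    moreover have "\<bar>(\<Sum>l\<in>{0..<b}. indicator R l) - \<alpha> * real_of_int b\<bar> \<le> \<eta> / 8 * real_of_int b"
      by (rule m1(2)) (use ab cm in auto)
    moreover have "\<bar>(\<Sum>l\<in>{0..<b-e}. indicator R' l) - \<rho> * real_of_int (b - e)\<bar> \<le> \<eta> / 8 * real_of_int (b - e)"
      by (rule m2(2)) (use ab cm in auto)
    ultimately have "\<alpha> * b - \<eta> / 8 * b - \<alpha> * a - \<eta> / 8 * a
        \<le> real_of_int (b - e) - \<rho> * real_of_int (b - e) + \<eta> / 8 * real_of_int (b - e)"
      by linarith
    moreover have "\<rho> = \<eta> + 1 - \<alpha>" by (simp add: \<eta>_def)
    ultimately have "\<eta> * (b - e) \<le> \<alpha> * (a - e) + \<eta> / 8 * (a + 2 * b - e)"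
      by (simp add: field_simps)
    also have "\<dots> \<le> \<bar>\<alpha>\<bar> * c + \<eta> / 8 * (2 * n + 3 * c)"
      using a b \<eta> by (intro add_mono mult_mono mult_left_mono) auto
    finally have 1: "\<eta> * (b - e) \<le> \<bar>\<alpha>\<bar> * c + \<eta> / 8 * (2 * n + 3 * c)" by simp
    have "\<eta> * (n / 2 - 2 * c) \<le> \<eta> * (b - e)"
      using b e \<eta> by (intro mult_left_mono) linarith+
    with 1 have "\<eta> * n \<le> 4 * (\<bar>\<alpha>\<bar> * c) + 19 / 2 * (\<eta> * c)" by (simp add: algebra_simps)
    moreover have "10 * (\<eta> * c) + 4 * (\<bar>\<alpha>\<bar> * c) + 4 * c < \<eta> * n1"
      using n1 \<eta> by (simp add: field_simps)
    moreover have "\<eta> * n1 \<le> \<eta> * n" using n \<eta> by (intro mult_left_mono) linarith+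
    moreover have "0 < \<eta> * c" using c \<eta> by simp
    ultimately show False using c by linarith
  qed
  define n2 where "n2 = max (8 * c) (int n1)"
  define D where "D = Max (insert C (F ` {0..n2}))"
  have "F n \<le> D" if "n \<ge> 0" for n
  proof (cases "n \<ge> n2")
    case True
    then have "F n \<le> C" using large by (simp add: n2_def)
    also have "C \<le> D" unfolding D_def by (intro Max_ge) auto
    finally show ?thesis .
  next
    case False
    with that show ?thesis unfolding D_def by (intro Max_ge) auto
  qed
  then show ?thesis by blast
qed

section \<open>Two-sided cocycles\<close>

text \<open>\<open>Tpow\<close> with the inverse as an explicit argument, so that time reversal is
  the exchange of T and V.\<close>

definition zpow :: "('a \<Rightarrow> 'a) \<Rightarrow> ('a \<Rightarrow> 'a) \<Rightarrow> int \<Rightarrow> 'a \<Rightarrow> 'a" where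
  "zpow T V i = (if 0 \<le> i then T ^^ nat i else V ^^ nat (- i))"

text \<open>One of the two sums is always empty; the sign makes the increment from n to n + 1 equal
  to f at time n for negative n as well.\<close>

definition cocycle :: "('a \<Rightarrow> 'a) \<Rightarrow> ('a \<Rightarrow> 'a) \<Rightarrow> ('a \<Rightarrow> real) \<Rightarrow> int \<Rightarrow> 'a \<Rightarrow> real" where
  "cocycle T V f n x = (\<Sum>i\<in>{0..<n}. f (zpow T V i x)) - (\<Sum>i\<in>{n..<0}. f (zpow T V i x))"

lemma zpow_swap: "zpow V T i = zpow T V (- i)"
  by (auto simp: zpow_def)

lemma zpow_0 [simp]: "zpow T V 0 x = x"
  by (simp add: zpow_def)

lemma zpow_of_nat: "zpow T V (int n) = T ^^ n"
  by (simp add: zpow_def)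

lemma zpow_minus_of_nat: "zpow T V (- int n) = V ^^ n"
  by (simp add: zpow_def)

lemma cocycle_0 [simp]: "cocycle T V f 0 x = 0"
  by (simp add: cocycle_def)

lemma cocycle_step: "cocycle T V f (n + 1) x = cocycle T V f n x + f (zpow T V n x)"
proof (cases "0 \<le> n")
  case True
  then have "{0..<n + 1} = insert n {0..<n}" by auto
  with True show ?thesis by (simp add: cocycle_def)
next
  case False
  then have "{n..<0} = insert n {n + 1..<0}" by auto
  with False show ?thesis by (simp add: cocycle_def)
qed

lemma cocycle_step_back: "cocycle T V f (n - 1) x = cocycle T V f n x - f (zpow T V (n - 1) x)"
  using cocycle_step[of T V f "n - 1" x] by simp

lemma cocycle_1: "cocycle T V f 1 x = f x"
  using cocycle_step[of T V f 0 x] by simp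

lemma sum_eq_cocycle_diff:
  "a \<le> b \<Longrightarrow> (\<Sum>i\<in>{a..<b}. f (zpow T V i x)) = cocycle T V f b x - cocycle T V f a x"
proof (induction b rule: int_ge_induct)
  case (step b)
  then have "{a..<b + 1} = insert b {a..<b}" by auto
  with step show ?case by (simp add: cocycle_step)
qed simp

lemma cocycle_of_nat: "cocycle T V f (int n) x = orbit_sum T f n x"
proof (induction n)
  case (Suc n)
  then show ?case
    using cocycle_step[of T V f "int n" x] by (simp add: orbit_sum_def zpow_of_nat add.commute)
qed simp

lemma cocycle_diff_const: "cocycle T V (\<lambda>x. f x - c) n x = cocycle T V f n x - c * of_int n"
  by (induction n rule: int_induct[where k = 0])
     (simp_all add: cocycle_step cocycle_step_back algebra_simps)

text \<open>Telescoping along one orbit. The coboundary equation is assumed on this orbit only,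
  since the equations for g and k in \<open>AE_cocycle_average\<close> are available almost
  everywhere.\<close>

lemma cocycle_coboundary:
  assumes "\<And>i. g (zpow T V i x) = h (zpow T V i x) - h (zpow T V (i + 1) x) - f (zpow T V i x)"
  shows "cocycle T V g n x = h x - h (zpow T V n x) - cocycle T V f n x"
proof (induction n rule: int_induct[where k = 0])
  case (step2 i)
  then show ?case using assms[of "i - 1"] by (simp add: cocycle_step_back)
qed (simp_all add: cocycle_step assms)

section \<open>Invertible systems and time reversal\<close>

locale ergodic_pair = ergodic_mpt M T for M :: "'a measure" and T +
  fixes V :: "'a \<Rightarrow> 'a"
  assumes V_measurable [measurable]: "V \<in> M \<rightarrow>\<^sub>M M"
    and V_T [simp]: "\<And>x. x \<in> space M \<Longrightarrow> V (T x) = x"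
    and T_V [simp]: "\<And>x. x \<in> space M \<Longrightarrow> T (V x) = x"
begin

text \<open>Pushing M, which is its own image under T, forward by V gives the law of the identity; a
  V-invariant set is T-invariant because the maps are inverse on \<open>space M\<close>. Every
  forward result thus has a backward version.\<close>

lemma reverse: "ergodic_pair M V T"
proof unfold_locales
  have "distr M M V = distr (distr M M T) M V" by (simp add: distr_T)
  also have "\<dots> = distr M M (V \<circ> T)" by (rule distr_distr) auto
  also have "\<dots> = distr M M (\<lambda>x. x)" by (rule distr_cong) auto
  finally show "distr M M V = M" by simp
next
  fix A assume A: "A \<in> sets M" "V -` A \<inter> space M = A"
  have "T -` A \<inter> space M = A"
  proof (intro set_eqI iffI)
    fix x assume "x \<in> T -` A \<inter> space M"
    then have "T x \<in> A" and x: "x \<in> space M" by auto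
    then have "T x \<in> V -` A \<inter> space M" using A(2) by simp
    with x show "x \<in> A" by simp
  next
    fix x assume "x \<in> A"
    then have x: "x \<in> space M" using sets.sets_into_space[OF A(1)] by auto
    then have "T x \<in> V -` A \<inter> space M" using \<open>x \<in> A\<close> by (auto intro: T_space)
    with A(2) x show "x \<in> T -` A \<inter> space M" by auto
  qed
  then show "prob A = 0 \<or> prob A = 1" by (rule ergodic_T[OF A(1)])
qed auto

lemma zpow_measurable [measurable]: "zpow T V i \<in> M \<rightarrow>\<^sub>M M"
proof -
  interpret V: ergodic_pair M V T by (rule reverse)
  show ?thesis unfolding zpow_def by simp
qed

lemma zpow_space: "x \<in> space M \<Longrightarrow> zpow T V i x \<in> space M"
  using measurable_space[OF zpow_measurable] .

lemma cocycle_measurable [measurable]: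
  assumes [measurable]: "f \<in> borel_measurable M"
  shows "cocycle T V f n \<in> borel_measurable M"
  unfolding cocycle_def by measurable

lemma zpow_Suc:
  assumes "x \<in> space M"
  shows "zpow T V (i + 1) x = T (zpow T V i x)"
proof (cases "0 \<le> i")
  case True
  then show ?thesis by (simp add: zpow_def nat_add_distrib)
next
  case False
  define n where "n = nat (- i - 1)"
  then have i: "i = - int (Suc n)" using False by simp
  then have "i + 1 = - int n" by simp
  moreover have "zpow T V i x = V (zpow T V (- int n) x)"
    unfolding i zpow_minus_of_nat by simp
  ultimately show ?thesis using assms zpow_space by simp
qed

lemma zpow_add:
  assumes "x \<in> space M"
  shows "zpow T V (i + j) x = zpow T V i (zpow T V j x)"
proof (induction i rule: int_induct[where k = 0])
  case (step1 i)
  then show ?case using zpow_Suc[OF assms, of "i + j"] zpow_Suc[OF zpow_space[OF assms], of i j]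
    by (simp add: algebra_simps)
next
  case (step2 i)
  have "T (zpow T V (i - 1 + j) x) = zpow T V (i + j) x"
    using zpow_Suc[OF assms, of "i - 1 + j"] by simp
  also have "\<dots> = T (zpow T V (i - 1) (zpow T V j x))"
    using zpow_Suc[OF zpow_space[OF assms], of "i - 1" j] step2 by simp
  finally have "V (T (zpow T V (i - 1 + j) x)) = V (T (zpow T V (i - 1) (zpow T V j x)))" by simp
  then show ?case using assms zpow_space by simp
qed simp

lemma zpow_pred:
  assumes "x \<in> space M"
  shows "zpow T V (i - 1) x = V (zpow T V i x)"
  using zpow_Suc[OF assms, of "i - 1"] assms zpow_space by simp

lemma cocycle_add:
  assumes "x \<in> space M"
  shows "cocycle T V f (m + n) x = cocycle T V f m x + cocycle T V f n (zpow T V m x)"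
proof (induction n rule: int_induct[where k = 0])
  case (step1 i)
  then show ?case using zpow_add[OF assms, of i m] cocycle_step[of T V f "m + i" x]
    by (simp add: cocycle_step add.assoc add.commute[of i m])
next
  case (step2 i)
  then show ?case using zpow_add[OF assms, of "i - 1" m] cocycle_step_back[of T V f "m + i" x]
    by (simp add: cocycle_step_back algebra_simps)
qed simp

text \<open>Going backward, the sum over n steps runs over the times -1 to -n, hence
  \<open>f (V x)\<close> rather than \<open>f x\<close>.\<close>

lemma cocycle_reverse:
  assumes "x \<in> space M"
  shows "cocycle V T (\<lambda>x. f (V x)) n x = - cocycle T V f (- n) x"
proof (induction n rule: int_induct[where k = 0])
  case (step1 i)
  then show ?case using zpow_pred[OF assms, of "- i"] cocycle_step_back[of T V f "- i" x]
    by (simp add: cocycle_step zpow_swap[of V T])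
next
  case (step2 i)
  then show ?case using zpow_pred[OF assms, of "- (i - 1)"] cocycle_step[of T V f "- i" x]
    by (simp add: cocycle_step_back zpow_swap[of V T])
qed simp

section \<open>Recurrence and boundedness on half-orbits\<close>

text \<open>The sublevel sets of W exhaust the space, so one of them has positive probability and is
  visited infinitely often.\<close>

lemma ex_recurrent_bound:
  assumes [measurable]: "(W :: 'a \<Rightarrow> real) \<in> borel_measurable M"
  shows "\<exists>B. AE x in M. \<forall>N. \<exists>n\<ge>N. W ((T ^^ n) x) \<le> B"
proof -
  have "(\<lambda>k::nat. prob {x\<in>space M. W x \<le> real k}) \<longlonglongrightarrow> prob (\<Union>k::nat. {x\<in>space M. W x \<le> real k})"
    by (rule finite_Lim_measure_incseq) (auto simp: incseq_def)
  also have "(\<Union>k::nat. {x\<in>space M. W x \<le> real k}) = space M"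
    using real_arch_simple by blast
  finally have "eventually (\<lambda>k::nat. prob {x\<in>space M. W x \<le> real k} > 0) sequentially"
    by (rule order_tendstoD) (simp add: prob_space)
  then obtain k :: nat where k: "prob {x\<in>space M. W x \<le> real k} > 0"
    by (auto simp: eventually_sequentially)
  have "AE x in M. \<forall>N. \<exists>n\<ge>N. W ((T ^^ n) x) \<le> real k"
    by (rule AE_mp[OF visits_infinitely_often[OF _ k]]) (measurable, blast)
  then show ?thesis by blast
qed

text \<open>Reduction to \<open>bounded_by_reflections\<close> with R the set of visit times to A.
  \<open>E J\<close> collects the points whose orbit is in A at one of the times -J to 0; backward
  recurrence makes its probability tend to 1, so for some J its complement has smaller probability
  than A.\<close>

lemma AE_bdd_above_if_reflection:
  assumes A [measurable]: "A \<in> sets M" and pos: "prob A > 0"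
    and refl: "\<And>x n. x \<in> A \<Longrightarrow> n \<ge> N \<Longrightarrow> cocycle T V f (p + n) x \<le> cocycle T V f (- n) x"
  shows "AE x in M. \<exists>B. \<forall>n\<ge>0. cocycle T V f n x \<le> B"
proof -
  interpret V: ergodic_pair M V T by (rule reverse)
  define E where "E J = {y\<in>space M. \<exists>i\<le>J. (V ^^ i) y \<in> A}" for J :: nat
  have E [measurable]: "E J \<in> sets M" for J unfolding E_def by measurable
  have "(\<lambda>J. prob (E J)) \<longlonglongrightarrow> prob (\<Union>J. E J)"
    by (rule finite_Lim_measure_incseq) (auto simp: incseq_def E_def intro: order_trans)
  also have "prob (\<Union>J. E J) = 1"
  proof (subst prob_eq_1)
    show "AE x in M. x \<in> (\<Union>J. E J)"
      using V.visits_infinitely_often[OF A pos] AE_space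
      by eventually_elim (unfold E_def, blast)
  qed measurable
  finally have "eventually (\<lambda>J. prob (E J) > 1 - prob A) sequentially"
    by (rule order_tendstoD) (use pos in simp)
  then obtain J where J: "prob (E J) > 1 - prob A" by (auto simp: eventually_sequentially)
  show ?thesis
    using visit_frequency[OF A] visit_frequency[OF E[of J]] visits_infinitely_often[OF A pos] AE_space
  proof eventually_elim
    fix x assume lims: "(\<lambda>n. orbit_sum T (indicator A) n x / real n) \<longlonglongrightarrow> prob A"
        "(\<lambda>n. orbit_sum T (indicator (E J)) n x / real n) \<longlonglongrightarrow> prob (E J)"
      and inf: "\<forall>N. \<exists>n\<ge>N. (T ^^ n) x \<in> A" and x: "x \<in> space M"
    define R where "R = {k. zpow T V k x \<in> A}"
    define R' where "R' = {m. \<exists>i\<le>J. m - int i \<in> R}"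
    \<comment> \<open>The delay i may exceed n, so R has to record negative times too.\<close>
    have "zpow T V (int n - int i) x = (V ^^ i) ((T ^^ n) x)" for i n
      using zpow_add[OF x, of "- int i" "int n"] by (simp add: zpow_of_nat zpow_minus_of_nat)
    then have "int n \<in> R' \<longleftrightarrow> (T ^^ n) x \<in> E J" for n
      using zpow_space[OF x, of "int n"] unfolding R'_def R_def E_def by (simp add: zpow_of_nat)
    moreover have "int n \<in> R \<longleftrightarrow> (T ^^ n) x \<in> A" for n
      by (simp add: R_def zpow_of_nat)
    ultimately have ind: "indicator R (int n) = (indicator A ((T ^^ n) x) :: real)"
      "indicator R' (int n) = (indicator (E J) ((T ^^ n) x) :: real)" for n
      by (simp_all add: indicator_def)
    show "\<exists>B. \<forall>n\<ge>0. cocycle T V f n x \<le> B"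
    proof (rule bounded_by_reflections[where R = R and J = J and p = p and N = N])
      fix k n assume k: "k \<in> R" and n: "n \<ge> N"
      have "cocycle T V f (k + (p + n)) x \<le> cocycle T V f (k + (- n)) x"
        unfolding cocycle_add[OF x] using refl[OF _ n, of "zpow T V k x"] k by (simp add: R_def)
      then show "cocycle T V f (k + p + n) x \<le> cocycle T V f (k - n) x"
        by (simp add: add.assoc)
    next
      show "(\<lambda>n. (\<Sum>i<n. indicator R (int i)) / real n) \<longlonglongrightarrow> prob A"
        using lims(1) by (simp add: ind orbit_sum_def)
      show "(\<lambda>n. (\<Sum>i<n. indicator {m. \<exists>i\<le>J. m - int i \<in> R} (int i)) / real n) \<longlonglongrightarrow> prob (E J)"
        unfolding R'_def[symmetric] using lims(2) by (simp add: ind orbit_sum_def)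
      show "1 - prob (E J) < prob A" using J by simp
    next
      fix b :: int
      obtain n where "n \<ge> nat b" "(T ^^ n) x \<in> A" using inf by blast
      then show "\<exists>k\<in>R. k \<ge> b" by (intro bexI[of _ "int n"]) (auto simp: R_def zpow_of_nat)
    qed
  qed
qed

end

section \<open>Limits of averages in the extended reals\<close>

lemma tendsto_ereal_add_real:
  fixes r u :: "nat \<Rightarrow> real" and \<gamma> :: ereal
  assumes "r \<longlonglongrightarrow> \<rho>" and "(\<lambda>n. ereal (u n)) \<longlonglongrightarrow> \<gamma>"
  shows "(\<lambda>n. ereal (r n + u n)) \<longlonglongrightarrow> ereal \<rho> + \<gamma>"
  using tendsto_add_ereal_general2[of "ereal \<rho>" "\<lambda>n. ereal (r n)" _ "\<lambda>n. ereal (u n)"] assms by simp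

text \<open>Boundedness keeps the supremum finite; at \<infinity>, \<open>real_of_ereal\<close>
  would return its default value 0.\<close>

lemma real_of_ereal_SUP_upper:
  fixes u :: "nat \<Rightarrow> real"
  assumes "\<And>n. u n \<le> B"
  shows "u n \<le> real_of_ereal (SUP n. ereal (u n))"
proof -
  have "ereal (u n) \<le> (SUP n. ereal (u n))" by (rule SUP_upper) simp
  moreover have "(SUP n. ereal (u n)) \<le> ereal B" by (rule SUP_least) (use assms in simp)
  ultimately show ?thesis by (cases "SUP n. ereal (u n)") auto
qed

lemma real_of_ereal_SUP_least:
  fixes u :: "nat \<Rightarrow> real"
  assumes "\<And>n. u n \<le> B"
  shows "real_of_ereal (SUP n. ereal (u n)) \<le> B"
proof -
  have "ereal (u 0) \<le> (SUP n. ereal (u n))" by (rule SUP_upper) simp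
  moreover have "(SUP n. ereal (u n)) \<le> ereal B" by (rule SUP_least) (use assms in simp)
  ultimately show ?thesis by (cases "SUP n. ereal (u n)") auto
qed

text \<open>If \<gamma> < \<kappa>, two reals r < s strictly between them force
  \<open>b n - a n\<close> above (s - r) n for large n, hence eventually above B.\<close>

lemma averages_le_if_frequently_bounded_diff:
  fixes a b :: "nat \<Rightarrow> real" and \<gamma> \<kappa> :: ereal
  assumes a: "(\<lambda>n. ereal (a n / real n)) \<longlonglongrightarrow> \<gamma>" and b: "(\<lambda>n. ereal (b n / real n)) \<longlonglongrightarrow> \<kappa>"
    and freq: "\<And>N. \<exists>n\<ge>N. b n - a n \<le> B"
  shows "\<kappa> \<le> \<gamma>"
proof (rule ccontr)
  assume "\<not> \<kappa> \<le> \<gamma>"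
  then obtain r s :: real where r: "\<gamma> < ereal r" and rs: "r < s" and s: "ereal s < \<kappa>"
    by (metis ereal_dense2 less_ereal.simps(1) not_le)
  obtain N where N: "B / (s - r) < real N" using reals_Archimedean2 by blast
  have "eventually (\<lambda>n. a n / real n < r \<and> s < b n / real n \<and> N < n) sequentially"
    using order_tendstoD(2)[OF a r] order_tendstoD(1)[OF b s] eventually_gt_at_top[of N]
    by eventually_elim auto
  then obtain N' where N': "\<And>n. n \<ge> N' \<Longrightarrow> a n / real n < r \<and> s < b n / real n \<and> N < n"
    by (auto simp: eventually_sequentially)
  obtain n where n: "n \<ge> N'" "b n - a n \<le> B" using freq by blast
  have "N < n" using N'[OF n(1)] by simp
  then have "a n < r * n" "s * n < b n" using N'[OF n(1)] by (auto simp: field_simps)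
  then have "(s - r) * n < B" using n(2) by (simp add: algebra_simps)
  moreover have "B < (s - r) * N" using N rs by (simp add: field_simps)
  moreover have "(s - r) * N \<le> (s - r) * n" using \<open>N < n\<close> rs by (intro mult_left_mono) auto
  ultimately show False by linarith
qed

lemma average_tendsto_sandwich:
  fixes a b u :: "nat \<Rightarrow> real" and \<gamma> :: ereal
  assumes a: "(\<lambda>n. ereal (a n / real n)) \<longlonglongrightarrow> \<gamma>" and b: "(\<lambda>n. ereal (b n / real n)) \<longlonglongrightarrow> \<gamma>"
    and up: "\<And>n. u n \<le> C - a n" and lo: "\<And>n. D - b n \<le> u n"
  shows "(\<lambda>n. ereal (u n / real n)) \<longlonglongrightarrow> - \<gamma>"
proof (rule tendsto_sandwich)
  have lim: "(\<lambda>n. ereal ((K - w n) / real n)) \<longlonglongrightarrow> - \<gamma>"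
    if "(\<lambda>n. ereal (w n / real n)) \<longlonglongrightarrow> \<gamma>" for w K
  proof -
    have "(\<lambda>n. ereal (K / real n + - (w n / real n))) \<longlonglongrightarrow> ereal 0 + - \<gamma>"
      using tendsto_uminus_ereal[OF that] by (intro tendsto_ereal_add_real lim_const_over_n) simp
    then show ?thesis by (simp add: diff_divide_distrib)
  qed
  show "(\<lambda>n. ereal ((D - b n) / real n)) \<longlonglongrightarrow> - \<gamma>" by (rule lim[OF b])
  show "(\<lambda>n. ereal ((C - a n) / real n)) \<longlonglongrightarrow> - \<gamma>" by (rule lim[OF a])
qed (use up lo in \<open>auto intro!: always_eventually divide_right_mono\<close>)

lemma (in ergodic_mpt) AE_funpow: "AE x in M. P x \<Longrightarrow> AE x in M. P ((T ^^ n) x)"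
proof (induction n arbitrary: P)
  case (Suc n)
  then show ?case using Suc.IH[of "\<lambda>x. P (T x)"] AE_T[of P] by simp
qed simp

context ergodic_pair
begin

lemma AE_zpow:
  assumes "AE x in M. P x"
  shows "AE x in M. P (zpow T V i x)"
proof -
  interpret V: ergodic_pair M V T by (rule reverse)
  show ?thesis unfolding zpow_def using AE_funpow[OF assms] V.AE_funpow[OF assms] by simp
qed

text \<open>The one-sided suprema turn f into a coboundary minus a nonnegative function, whose
  averages converge. Since m + l need not be integrable, the limits for g and k are compared through
  recurrence rather than by integrating their difference.\<close>

lemma AE_cocycle_average:
  assumes f [measurable]: "f \<in> borel_measurable M"
    and up: "AE x in M. \<exists>B. \<forall>n\<ge>0. cocycle T V f n x \<le> B"
    and lo: "AE x in M. \<exists>B. \<forall>n\<ge>0. - cocycle T V f (- n) x \<le> B"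
  shows "\<exists>\<gamma>::ereal. \<gamma> \<ge> 0 \<and> (AE x in M.
    (\<lambda>n. ereal (cocycle T V f (int n) x / real n)) \<longlonglongrightarrow> - \<gamma> \<and>
    (\<lambda>n. ereal (- cocycle T V f (- int n) x / real n)) \<longlonglongrightarrow> - \<gamma>)"
proof -
  interpret V: ergodic_pair M V T by (rule reverse)
  \<comment> \<open>The truncation in g and k and the junk value of real_of_ereal only matter on a null set.\<close>
  define m where "m x = real_of_ereal (SUP n. ereal (cocycle T V f (int n) x))" for x
  define l where "l x = real_of_ereal (SUP n. ereal (- cocycle T V f (- int n) x))" for x
  have [measurable]: "m \<in> borel_measurable M" "l \<in> borel_measurable M"
    unfolding m_def l_def by measurable
  define g where "g x = max 0 (m x - m (T x) - f x)" for x
  define k where "k x = max 0 (l (T x) - l x - f x)" for x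
  have g_meas [measurable]: "g \<in> borel_measurable M" and k_meas [measurable]: "k \<in> borel_measurable M"
    unfolding g_def k_def by measurable
  have nonneg: "0 \<le> g x" "0 \<le> k x" for x by (auto simp: g_def k_def)
  define good where "good x \<longleftrightarrow> x \<in> space M \<and> (\<exists>B. \<forall>n\<ge>0. cocycle T V f n x \<le> B)
    \<and> (\<exists>B. \<forall>n\<ge>0. - cocycle T V f (- n) x \<le> B)" for x
  have "AE x in M. good x" using up lo AE_space by eventually_elim (simp add: good_def)
  then have AE_good: "AE x in M. \<forall>i. good (zpow T V i x)"
    unfolding AE_all_countable using AE_zpow by blast
  have m_ge: "cocycle T V f (int n) x \<le> m x" if "good x" for x n
  proof -
    obtain B where "\<forall>n\<ge>0. cocycle T V f n x \<le> B" using \<open>good x\<close> by (auto simp: good_def)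
    then show ?thesis unfolding m_def by (intro real_of_ereal_SUP_upper[of _ B]) simp
  qed
  have l_ge: "- cocycle T V f (- int n) x \<le> l x" if "good x" for x n
  proof -
    obtain B where "\<forall>n\<ge>0. - cocycle T V f (- n) x \<le> B" using \<open>good x\<close> by (auto simp: good_def)
    then show ?thesis unfolding l_def by (intro real_of_ereal_SUP_upper[of _ B]) simp
  qed
  have m0: "0 \<le> m x" and l0: "0 \<le> l x" if "good x" for x
    using m_ge[OF that, of 0] l_ge[OF that, of 0] by simp_all
  \<comment> \<open>\<open>m x\<close> bounds f x plus every forward sum from T x, so the truncation
    at 0 has no effect at good points.\<close>
  have g_eq: "g x = m x - m (T x) - f x" if x: "good x" for x
  proof -
    have "m (T x) \<le> m x - f x" unfolding m_def[of "T x"]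
    proof (rule real_of_ereal_SUP_least)
      fix n
      have "cocycle T V f (1 + int n) x = f x + cocycle T V f (int n) (T x)"
        using cocycle_add[of x f 1 "int n"] zpow_Suc[of x 0] x by (simp add: good_def cocycle_1)
      then show "cocycle T V f (int n) (T x) \<le> m x - f x" using m_ge[OF x, of "Suc n"] by simp
    qed
    then show ?thesis by (simp add: g_def)
  qed
  \<comment> \<open>The sum over n backward steps from x is the sum over n + 1 backward steps from T
    x without its term f x; hence T x is asked to be good as well.\<close>
  have k_eq: "k x = (- l x) - (- l (T x)) - f x" if x: "good x" and Tx: "good (T x)" for x
  proof -
    have "l x \<le> l (T x) - f x" unfolding l_def[of x]
    proof (rule real_of_ereal_SUP_least)
      fix n
      have "cocycle T V f (1 + - int (Suc n)) x = f x + cocycle T V f (- int (Suc n)) (T x)"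
        using cocycle_add[of x f 1 "- int (Suc n)"] zpow_Suc[of x 0] x
        by (simp add: good_def cocycle_1)
      then show "- cocycle T V f (- int n) x \<le> l (T x) - f x" using l_ge[OF Tx, of "Suc n"] by simp
    qed
    then show ?thesis by (simp add: k_def)
  qed
  define \<gamma> where "\<gamma> = enn2ereal (\<integral>\<^sup>+x. ennreal (g x) \<partial>M)"
  define \<kappa> where "\<kappa> = enn2ereal (\<integral>\<^sup>+x. ennreal (k x) \<partial>M)"
  \<comment> \<open>The backward half is Birkhoff's theorem for V and \<open>h (V x)\<close>, which
    has the same integral as h.\<close>
  have lims: "AE x in M. (\<lambda>n. ereal (cocycle T V h (int n) x / real n)) \<longlonglongrightarrow> enn2ereal (\<integral>\<^sup>+x. ennreal (h x) \<partial>M)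
      \<and> (\<lambda>n. ereal (- cocycle T V h (- int n) x / real n)) \<longlonglongrightarrow> enn2ereal (\<integral>\<^sup>+x. ennreal (h x) \<partial>M)"
    if [measurable]: "h \<in> borel_measurable M" and "\<And>x. 0 \<le> h x" for h
  proof -
    have "AE x in M. (\<lambda>n. ereal (orbit_sum V (\<lambda>x. h (V x)) n x / real n))
        \<longlonglongrightarrow> enn2ereal (\<integral>\<^sup>+x. ennreal (h (V x)) \<partial>M)"
      by (rule V.birkhoff_nonneg) (use that in auto)
    moreover have "(\<integral>\<^sup>+x. ennreal (h (V x)) \<partial>M) = (\<integral>\<^sup>+x. ennreal (h x) \<partial>M)"
      by (rule V.nn_integral_T) measurable
    ultimately have "AE x in M. (\<lambda>n. ereal (orbit_sum V (\<lambda>x. h (V x)) n x / real n))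
        \<longlonglongrightarrow> enn2ereal (\<integral>\<^sup>+x. ennreal (h x) \<partial>M)"
      by simp
    with birkhoff_nonneg[OF that] AE_space show ?thesis
      by eventually_elim
        (simp flip: cocycle_of_nat[of V T] cocycle_of_nat[of T V] minus_divide_left add: cocycle_reverse)
  qed
  obtain B where B: "AE x in M. \<forall>N. \<exists>n\<ge>N. m ((T ^^ n) x) + l ((T ^^ n) x) \<le> B"
    using ex_recurrent_bound[of "\<lambda>x. m x + l x"] by auto
  obtain B' where B': "AE x in M. \<forall>N. \<exists>n\<ge>N. m ((V ^^ n) x) + l ((V ^^ n) x) \<le> B'"
    using V.ex_recurrent_bound[of "\<lambda>x. m x + l x"] by auto
  have main: "AE x in M. \<gamma> = \<kappa> \<and>
    (\<lambda>n. ereal (cocycle T V f (int n) x / real n)) \<longlonglongrightarrow> - \<gamma> \<and>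
    (\<lambda>n. ereal (- cocycle T V f (- int n) x / real n)) \<longlonglongrightarrow> - \<gamma>"
    using AE_good lims[OF g_meas nonneg(1)] lims[OF k_meas nonneg(2)] B B' AE_space
  proof (eventually_elim, goal_cases)
    case (1 x)
    have x: "x \<in> space M" by fact
    have lg: "(\<lambda>n. ereal (cocycle T V g (int n) x / real n)) \<longlonglongrightarrow> \<gamma>"
      "(\<lambda>n. ereal (- cocycle T V g (- int n) x / real n)) \<longlonglongrightarrow> \<gamma>"
      and lk: "(\<lambda>n. ereal (cocycle T V k (int n) x / real n)) \<longlonglongrightarrow> \<kappa>"
      "(\<lambda>n. ereal (- cocycle T V k (- int n) x / real n)) \<longlonglongrightarrow> \<kappa>"
      using 1 unfolding \<gamma>_def \<kappa>_def by blast+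
    have gd: "good (zpow T V i x)" for i using 1 by blast
    have G: "cocycle T V g n x = m x - m (zpow T V n x) - cocycle T V f n x" for n
      using gd by (intro cocycle_coboundary) (simp add: g_eq zpow_Suc[OF x])
    have "good (T (zpow T V i x))" for i using gd[of "i + 1"] by (simp add: zpow_Suc[OF x])
    then have K: "cocycle T V k n x = - l x - (- l (zpow T V n x)) - cocycle T V f n x" for n
      using gd by (intro cocycle_coboundary[where h = "\<lambda>x. - l x"]) (simp add: k_eq zpow_Suc[OF x])
    \<comment> \<open>The cocycle of k minus that of g is m + l at the current point minus m + l at
      x, which is bounded along return times. Backward averages carry the opposite sign and so give
      the opposite inequality.\<close>
    have "\<kappa> \<le> \<gamma>"
    proof (rule averages_le_if_frequently_bounded_diff[OF lg(1) lk(1)])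
      fix N
      obtain n where "n \<ge> N" "m ((T ^^ n) x) + l ((T ^^ n) x) \<le> B" using 1 by blast
      then show "\<exists>n\<ge>N. cocycle T V k (int n) x - cocycle T V g (int n) x \<le> B - (m x + l x)"
        by (intro exI[of _ n]) (simp add: G K zpow_of_nat)
    qed
    moreover have "\<gamma> \<le> \<kappa>"
    proof (rule averages_le_if_frequently_bounded_diff[OF lk(2) lg(2)])
      fix N
      obtain n where "n \<ge> N" "m ((V ^^ n) x) + l ((V ^^ n) x) \<le> B'" using 1 by blast
      then show "\<exists>n\<ge>N. - cocycle T V g (- int n) x - - cocycle T V k (- int n) x \<le> B' - (m x + l x)"
        by (intro exI[of _ n]) (simp add: G K zpow_minus_of_nat)
    qed
    ultimately have eq: "\<gamma> = \<kappa>" by simp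
    \<comment> \<open>Dropping the nonnegative value of m at the moving point gives the upper bound,
      dropping that of l the lower one; backward, m and l exchange roles.\<close>
    have "(\<lambda>n. ereal (cocycle T V f (int n) x / real n)) \<longlonglongrightarrow> - \<gamma>"
    proof (rule average_tendsto_sandwich[OF lg(1) lk(1)[folded eq]])
      fix n
      show "cocycle T V f (int n) x \<le> m x - cocycle T V g (int n) x"
        "- l x - cocycle T V k (int n) x \<le> cocycle T V f (int n) x"
        using m0[OF gd, of "int n"] l0[OF gd, of "int n"] by (simp_all add: G K)
    qed
    moreover have "(\<lambda>n. ereal (- cocycle T V f (- int n) x / real n)) \<longlonglongrightarrow> - \<gamma>"
    proof (rule average_tendsto_sandwich[OF lk(2)[folded eq] lg(2)])
      fix n
      show "- cocycle T V f (- int n) x \<le> l x - - cocycle T V k (- int n) x"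
        "- m x - - cocycle T V g (- int n) x \<le> - cocycle T V f (- int n) x"
        using m0[OF gd, of "- int n"] l0[OF gd, of "- int n"] by (simp_all add: G K)
    qed
    ultimately show ?case using eq by blast
  qed
  then show ?thesis by (intro exI[of _ \<gamma>]) (auto simp: \<gamma>_def)
qed

end

section \<open>Bilateral averages\<close>

text \<open>The quotient is the mean of F (n + p) / (n + p) and - F (- n) / n with weights
  proportional to n + p and n, so it is below r once both are.\<close>

lemma eventually_bilateral_average_less:
  fixes F :: "int \<Rightarrow> real"
  assumes "eventually (\<lambda>n. F (int n) / real n < r) sequentially"
    and "eventually (\<lambda>n. - F (- int n) / real n < r) sequentially"
  shows "eventually (\<lambda>n. (F (int n + p) - F (- int n)) / (2 * real n + of_int p) < r) sequentially"
proof -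
  obtain N where N: "\<And>n. n \<ge> N \<Longrightarrow> F (int n) / real n < r \<and> - F (- int n) / real n < r"
    using eventually_conj[OF assms] by (auto simp: eventually_sequentially)
  have "(F (int n + p) - F (- int n)) / (2 * real n + of_int p) < r"
    if n: "n \<ge> N + nat \<bar>p\<bar> + 1" for n
  proof -
    define m where "m = nat (int n + p)"
    have m: "int n + p = int m" "m \<ge> N" "m \<ge> 1" using n by (auto simp: m_def)
    have "F (int m) < r * real m" "- F (- int n) < r * real n"
      using N[of m] N[of n] m n by (auto simp: field_simps)
    moreover have "real m = real n + of_int p" using m(1) by linarith
    ultimately have "F (int n + p) - F (- int n) < r * (2 * real n + of_int p)"
      unfolding m(1) by (simp add: algebra_simps)
    moreover have "2 * real n + of_int p > 0" using \<open>real m = real n + of_int p\<close> m n by linarith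
    ultimately show ?thesis by (simp add: divide_less_eq)
  qed
  then show ?thesis by (auto simp: eventually_sequentially)
qed

lemma bilateral_average_tendsto:
  fixes F :: "int \<Rightarrow> real" and c :: ereal
  assumes fwd: "(\<lambda>n. ereal (F (int n) / real n)) \<longlonglongrightarrow> c"
    and bwd: "(\<lambda>n. ereal (- F (- int n) / real n)) \<longlonglongrightarrow> c"
  shows "(\<lambda>n. ereal ((F (int n + p) - F (- int n)) / (2 * real n + of_int p))) \<longlonglongrightarrow> c"
proof (rule tendsto_ereal_if_rational_bounds)
  fix r :: rat assume "c < ereal (of_rat r)"
  from order_tendstoD(2)[OF fwd this] order_tendstoD(2)[OF bwd this]
  show "eventually (\<lambda>n. (F (int n + p) - F (- int n)) / (2 * real n + of_int p) < of_rat r) sequentially"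
    by (intro eventually_bilateral_average_less) simp_all
next
  fix r :: rat assume "ereal (of_rat r) < c"
  \<comment> \<open>Lower bounds for F are upper bounds for - F.\<close>
  then have "eventually (\<lambda>n. - F (int n) / real n < - of_rat r) sequentially"
    "eventually (\<lambda>n. - (- F (- int n)) / real n < - of_rat r) sequentially"
    using order_tendstoD(1)[OF fwd] order_tendstoD(1)[OF bwd]
    by (fastforce elim: eventually_mono)+
  then have "eventually (\<lambda>n. (- F (int n + p) - - F (- int n)) / (2 * real n + of_int p) < - of_rat r) sequentially"
    by (rule eventually_bilateral_average_less)
  then show "eventually (\<lambda>n. of_rat r < (F (int n + p) - F (- int n)) / (2 * real n + of_int p)) sequentially"
  proof eventually_elim
    case (elim n)
    moreover have "(- F (int n + p) - - F (- int n)) / (2 * real n + of_int p)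
      = - ((F (int n + p) - F (- int n)) / (2 * real n + of_int p))"
      by (simp only: minus_divide_left) simp
    ultimately show ?case by linarith
  qed
qed

section \<open>The averages expressed by the cocycle\<close>

lemma Tpow_eq_zpow: "Tpow M T = zpow T (inv_into (space M) T)"
  by (simp add: fun_eq_iff Tpow_def zpow_def)

lemma Bavg_eq_Bq: "Bavg M T f = Bq M T 0 f"
  by (simp add: fun_eq_iff Bavg_def Bq_def)

text \<open>The closed interval up to n + q is half-open up to n + 1 + q, which is the source of p =
  1 + q. The bound on n puts the endpoints in the right order.\<close>

lemma Bq_eq_cocycle:
  assumes "n \<ge> nat \<bar>q\<bar>"
  shows "Bq M T q f n x = (cocycle T (inv_into (space M) T) f (int n + (1 + q)) x
    - cocycle T (inv_into (space M) T) f (- int n) x) / (2 * real n + of_int (1 + q))"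
proof -
  have "{- int n..int n + q} = {- int n..<int n + (1 + q)}" by auto
  moreover have "- int n \<le> int n + (1 + q)" using assms by linarith
  ultimately show ?thesis
    unfolding Bq_def Tpow_eq_zpow by (simp add: sum_eq_cocycle_diff algebra_simps)
qed

lemma Bq_measurable:
  assumes "inv_mpt M T" and [measurable]: "f \<in> borel_measurable M"
  shows "Bq M T q f n \<in> borel_measurable M"
proof -
  have "T \<in> M \<rightarrow>\<^sub>M M" "inv_into (space M) T \<in> M \<rightarrow>\<^sub>M M" using assms(1) by (auto simp: inv_mpt_def)
  then have "T ^^ k \<in> M \<rightarrow>\<^sub>M M" "inv_into (space M) T ^^ k \<in> M \<rightarrow>\<^sub>M M" for k
    by (induction k) (auto intro: measurable_comp)
  then have [measurable]: "Tpow M T i \<in> M \<rightarrow>\<^sub>M M" for i by (simp add: Tpow_def)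
  show ?thesis unfolding Bq_def by measurable
qed

lemma ergodic_pair_inv_into:
  assumes "prob_space M" and inv: "inv_mpt M T" and erg: "ergodic M T"
  shows "ergodic_pair M T (inv_into (space M) T)"
proof -
  interpret prob_space M by fact
  have meas: "T \<in> M \<rightarrow>\<^sub>M M" and bij: "bij_betw T (space M) (space M)"
    and "inv_into (space M) T \<in> M \<rightarrow>\<^sub>M M"
    and pres: "\<And>A. A \<in> sets M \<Longrightarrow> emeasure M (T -` A \<inter> space M) = emeasure M A"
    using inv by (auto simp: inv_mpt_def)
  then show ?thesis
  proof unfold_locales
    show "distr M M T = M"
      by (rule measure_eqI) (use meas pres in \<open>auto simp: emeasure_distr\<close>)
    show "prob A = 0 \<or> prob A = 1" if "A \<in> sets M" "T -` A \<inter> space M = A" for A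
      using erg that unfolding ergodic_def by (auto simp: measure_def)
    show "inv_into (space M) T (T x) = x" if "x \<in> space M" for x
      using bij that by (auto simp: bij_betw_def inv_into_f_f)
    show "T (inv_into (space M) T x) = x" if "x \<in> space M" for x
      using bij that by (auto simp: bij_betw_def f_inv_into_f)
  qed
qed

text \<open>Otherwise A would be covered, up to a null set, by countably many null sets.\<close>

lemma (in prob_space) ex_pos_subset_of_countable_cover:
  fixes P :: "nat \<Rightarrow> 'a \<Rightarrow> bool"
  assumes A [measurable]: "A \<in> sets M" and pos: "prob A > 0"
    and [measurable]: "\<And>k. Measurable.pred M (P k)"
    and cover: "AE x in M. x \<in> A \<longrightarrow> (\<exists>k. P k x)"
  obtains k where "prob {x\<in>A. P k x} > 0"
proof (rule ccontr)
  have S: "{x\<in>A. P k x} \<in> sets M" for k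
  proof -
    have "{x\<in>A. P k x} = A \<inter> {x\<in>space M. P k x}" using sets.sets_into_space[OF A] by auto
    then show ?thesis by simp
  qed
  assume "\<not> thesis"
  then have "prob {x\<in>A. P k x} = 0" for k
    using that by (metis measure_nonneg less_le)
  then have "AE x in M. \<forall>k. x \<notin> {x\<in>A. P k x}"
    unfolding AE_all_countable using prob_eq_0[OF S] by blast
  with cover have "AE x in M. x \<notin> A" by eventually_elim auto
  with pos show False using prob_eq_0[OF A] by simp
qed

text \<open>One reflection inequality, read forward and in reversed time, bounds both half-orbits. A
  single c serves all asymmetries at once, which is what the equivalence of the two convergences
  rests on.\<close>

lemma AE_limits_if_limsup_finite:
  assumes "prob_space M" and inv: "inv_mpt M T" and erg: "ergodic M T"
    and f [measurable]: "f \<in> borel_measurable M"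
    and A: "A \<in> sets M" and pos: "emeasure M A > 0"
    and fin: "AE x in M. x \<in> A \<longrightarrow> limsup (\<lambda>n. ereal (Bq M T q f n x)) < \<infinity>"
  shows "\<exists>c::ereal. c \<noteq> \<infinity> \<and> (AE x in M. (\<lambda>n. ereal (Aplus M T f n x)) \<longlonglongrightarrow> c \<and>
    (\<lambda>n. ereal (Aminus M T f n x)) \<longlonglongrightarrow> c \<and> (\<forall>q. (\<lambda>n. ereal (Bq M T q f n x)) \<longlonglongrightarrow> c))"
proof -
  define V where "V = inv_into (space M) T"
  interpret ergodic_pair M T V
    unfolding V_def by (rule ergodic_pair_inv_into) fact+
  interpret V: ergodic_pair M V T by (rule reverse)
  note [measurable] = A Bq_measurable[OF inv f]
  have posA: "prob A > 0" using pos by (simp add: emeasure_eq_measure)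
  \<comment> \<open>The number k is both the bound and the index from which it holds, so that one
    natural parameter indexes the cover.\<close>
  obtain k :: nat where k: "prob {x\<in>A. \<forall>n\<ge>k. Bq M T q f n x \<le> real k} > 0"
  proof (rule ex_pos_subset_of_countable_cover[OF A posA])
    show "AE x in M. x \<in> A \<longrightarrow> (\<exists>k::nat. \<forall>n\<ge>k. Bq M T q f n x \<le> real k)"
      using fin
    proof (eventually_elim, intro impI)
      fix x assume "x \<in> A \<longrightarrow> limsup (\<lambda>n. ereal (Bq M T q f n x)) < \<infinity>" "x \<in> A"
      then obtain r where "limsup (\<lambda>n. ereal (Bq M T q f n x)) < ereal r"
        using ereal_dense2 by blast
      from Limsup_lessD[OF this] obtain N where N: "\<And>n. n \<ge> N \<Longrightarrow> Bq M T q f n x < r"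
        by (auto simp: eventually_sequentially)
      obtain N' :: nat where "r \<le> real N'" using real_arch_simple by blast
      with N have "Bq M T q f n x \<le> real (max N N')" if "n \<ge> max N N'" for n
        using that by (smt (verit) max.bounded_iff of_nat_mono max.cobounded2)
      then show "\<exists>k::nat. \<forall>n\<ge>k. Bq M T q f n x \<le> real k" by blast
    qed
  qed measurable
  define A' where "A' = {x\<in>A. \<forall>n\<ge>k. Bq M T q f n x \<le> real k}"
  have [measurable]: "A' \<in> sets M"
  proof -
    have "A' = A \<inter> {x\<in>space M. \<forall>n\<ge>k. Bq M T q f n x \<le> real k}"
      using sets.sets_into_space[OF A] by (auto simp: A'_def)
    then show ?thesis by simp
  qed
  \<comment> \<open>Subtracting k turns the bound on \<open>Bq\<close> into the statement that the
    cocycle does not increase from - n to n + 1 + q.\<close>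
  define h where "h x = f x - real k" for x
  have [measurable]: "h \<in> borel_measurable M" unfolding h_def by measurable
  have h_cocycle: "cocycle T V h n x = cocycle T V f n x - real k * of_int n" for n x
    unfolding h_def by (rule cocycle_diff_const)
  \<comment> \<open>From N on, the bound by k holds, \<open>Bq_eq_cocycle\<close> applies and the
    denominator is positive.\<close>
  define N where "N = int k + \<bar>q\<bar> + 1"
  have refl: "cocycle T V h (1 + q + n) x \<le> cocycle T V h (- n) x" if x: "x \<in> A'" and n: "n \<ge> N" for x n
  proof -
    define j where "j = nat n"
    have j: "n = int j" "j \<ge> nat \<bar>q\<bar>" "j \<ge> k" "2 * real j + of_int (1 + q) > 0"
      using n by (auto simp: j_def N_def)
    have "Bq M T q f j x \<le> real k" using x j by (simp add: A'_def)
    then have "cocycle T V f (int j + (1 + q)) x - cocycle T V f (- int j) x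
        \<le> real k * (2 * real j + of_int (1 + q))"
      using j unfolding Bq_eq_cocycle[OF j(2)] V_def[symmetric] by (simp add: divide_le_eq)
    then show ?thesis
      unfolding h_cocycle j(1) by (simp add: algebra_simps)
  qed
  have up: "AE x in M. \<exists>B. \<forall>n\<ge>0. cocycle T V h n x \<le> B"
    using k refl by (intro AE_bdd_above_if_reflection[of A']) (auto simp: A'_def)
  \<comment> \<open>In reversed time the inequality at n - (1 + q) is a reflection inequality with p
    = - (1 + q); the added \<open>\<bar>1 + q\<bar>\<close> keeps the shifted index at least
    N.\<close>
  have "AE x in M. \<exists>B. \<forall>n\<ge>0. cocycle V T (\<lambda>x. h (V x)) n x \<le> B"
  proof (rule V.AE_bdd_above_if_reflection[of A' "N + \<bar>1 + q\<bar>" _ "- (1 + q)"])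
    fix x n assume x: "x \<in> A'" and n: "n \<ge> N + \<bar>1 + q\<bar>"
    then have "x \<in> space M" using sets.sets_into_space[OF A] by (auto simp: A'_def)
    moreover have "cocycle T V h (1 + q + (n - (1 + q))) x \<le> cocycle T V h (- (n - (1 + q))) x"
      by (rule refl) (use x n in auto)
    ultimately show "cocycle V T (\<lambda>x. h (V x)) (- (1 + q) + n) x \<le> cocycle V T (\<lambda>x. h (V x)) (- n) x"
      by (simp add: cocycle_reverse algebra_simps)
  qed (use k in \<open>simp_all add: A'_def[symmetric]\<close>)
  with AE_space have lo: "AE x in M. \<exists>B. \<forall>n\<ge>0. - cocycle T V h (- n) x \<le> B"
    by eventually_elim (simp add: cocycle_reverse)
  obtain \<gamma> :: ereal where \<gamma>: "\<gamma> \<ge> 0" and lim: "AE x in M.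
    (\<lambda>n. ereal (cocycle T V h (int n) x / real n)) \<longlonglongrightarrow> - \<gamma> \<and>
    (\<lambda>n. ereal (- cocycle T V h (- int n) x / real n)) \<longlonglongrightarrow> - \<gamma>"
    using AE_cocycle_average[OF _ up lo] by auto
  \<comment> \<open>The constant k is added back; as \<gamma> is nonnegative, c may be - \<infinity>
    but not \<infinity>.\<close>
  define c where "c = ereal (real k) + - \<gamma>"
  have "AE x in M.
    (\<lambda>n. ereal (cocycle T V f (int n) x / real n)) \<longlonglongrightarrow> c \<and>
    (\<lambda>n. ereal (- cocycle T V f (- int n) x / real n)) \<longlonglongrightarrow> c"
    using lim
  proof eventually_elim
    case (elim x)
    have *: "eventually (\<lambda>n. ereal (real k + cocycle T V h (int n) x / real n) = ereal (cocycle T V f (int n) x / real n)) sequentially"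
      "eventually (\<lambda>n. ereal (real k + - cocycle T V h (- int n) x / real n) = ereal (- cocycle T V f (- int n) x / real n)) sequentially"
      by (rule eventually_mono[OF eventually_gt_at_top[of 0]],
          simp add: h_cocycle field_simps)+
    from elim have "(\<lambda>n. ereal (real k + cocycle T V h (int n) x / real n)) \<longlonglongrightarrow> c"
      "(\<lambda>n. ereal (real k + - cocycle T V h (- int n) x / real n)) \<longlonglongrightarrow> c"
      unfolding c_def using elim by (auto simp only: intro!: tendsto_ereal_add_real[OF tendsto_const])
    then show ?case
      using Lim_transform_eventually[OF _ *(1)] Lim_transform_eventually[OF _ *(2)] by blast
  qed
  from this AE_T[OF this] AE_space have "AE x in M. (\<lambda>n. ereal (Aplus M T f n x)) \<longlonglongrightarrow> c \<and>
    (\<lambda>n. ereal (Aminus M T f n x)) \<longlonglongrightarrow> c \<and> (\<forall>q. (\<lambda>n. ereal (Bq M T q f n x)) \<longlonglongrightarrow> c)"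
  proof eventually_elim
    case (elim x)
    have "Aplus M T f n x = cocycle T V f (int n) x / real n" for n
      by (simp add: Aplus_def cocycle_of_nat orbit_sum_def Tpow_eq_zpow zpow_of_nat)
    \<comment> \<open>Aminus starts at time 0, the backward cocycle at time -1: hence the shift to T x.\<close>
    moreover have "Aminus M T f n x = - cocycle T V f (- int n) (T x) / real n" for n
    proof -
      have x: "x \<in> space M" using elim by blast
      then have "(\<Sum>i<n. f ((V ^^ i) x)) = orbit_sum V (\<lambda>x. f (V x)) n (T x)"
        by (simp add: orbit_sum_def funpow_swap1)
      also have "\<dots> = - cocycle T V f (- int n) (T x)"
        unfolding cocycle_of_nat[of V T, symmetric] by (rule cocycle_reverse[OF T_space[OF x]])
      finally show ?thesis
        by (simp add: Aminus_def Tpow_eq_zpow V_def[symmetric] zpow_minus_of_nat)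
    qed
    moreover have "(\<lambda>n. ereal (Bq M T q f n x)) \<longlonglongrightarrow> c" for q
    proof (rule Lim_transform_eventually)
      show "(\<lambda>n. ereal ((cocycle T V f (int n + (1 + q)) x - cocycle T V f (- int n) x)
          / (2 * real n + of_int (1 + q)))) \<longlonglongrightarrow> c"
        by (rule bilateral_average_tendsto) (use elim in blast)+
      show "eventually (\<lambda>n. ereal ((cocycle T V f (int n + (1 + q)) x - cocycle T V f (- int n) x)
          / (2 * real n + of_int (1 + q))) = ereal (Bq M T q f n x)) sequentially"
        by (rule eventually_mono[OF eventually_ge_at_top[of "nat \<bar>q\<bar>"]])
           (simp add: Bq_eq_cocycle V_def)
    qed
    ultimately show ?case using elim by (simp only: simp_thms)
  qed
  moreover have "c \<noteq> \<infinity>" using \<gamma> unfolding c_def by (cases \<gamma>) auto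
  ultimately show ?thesis by blast
qed

text \<open>Convergence gives a finite limsup on the whole space, hence one extended limit c for all
  q. Since the averages for q converge in the reals, c is real, and those for q' converge in the
  reals too.\<close>

lemma AE_convergent_Bq:
  assumes ps: "prob_space M" and inv: "inv_mpt M T" and erg: "ergodic M T"
    and f: "f \<in> borel_measurable M"
    and conv: "AE x in M. convergent (\<lambda>n. Bq M T q f n x)"
  shows "AE x in M. convergent (\<lambda>n. Bq M T q' f n x)"
proof -
  interpret prob_space M by fact
  have "AE x in M. x \<in> space M \<longrightarrow> limsup (\<lambda>n. ereal (Bq M T q f n x)) < \<infinity>"
    using conv
  proof eventually_elim
    case (elim x)
    then obtain l where "(\<lambda>n. ereal (Bq M T q f n x)) \<longlonglongrightarrow> ereal l"
      by (auto simp: convergent_def)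
    then have "limsup (\<lambda>n. ereal (Bq M T q f n x)) = ereal l"
      by (rule lim_imp_Limsup[OF sequentially_bot])
    then show ?case by simp
  qed
  then obtain c :: ereal where "AE x in M. (\<lambda>n. ereal (Aplus M T f n x)) \<longlonglongrightarrow> c \<and>
    (\<lambda>n. ereal (Aminus M T f n x)) \<longlonglongrightarrow> c \<and> (\<forall>q. (\<lambda>n. ereal (Bq M T q f n x)) \<longlonglongrightarrow> c)"
    using AE_limits_if_limsup_finite[OF ps inv erg f sets.top, of q] emeasure_space_1 by auto
  with conv show ?thesis
  proof eventually_elim
    case (elim x)
    then obtain l where l: "(\<lambda>n. ereal (Bq M T q f n x)) \<longlonglongrightarrow> ereal l"
      by (auto simp: convergent_def)
    then have "c = ereal l" using elim LIMSEQ_unique by blast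
    with elim have "(\<lambda>n. ereal (Bq M T q' f n x)) \<longlonglongrightarrow> ereal l" by blast
    then show ?case by (auto simp: convergent_def)
  qed
qed

theorem theorem3:
  fixes M :: "'a measure" and T :: "'a \<Rightarrow> 'a" and f :: "'a \<Rightarrow> real" and q :: int
  assumes "prob_space M" and "inv_mpt M T" and "ergodic M T"
    and "f \<in> borel_measurable M"
  shows "((\<exists>A\<in>sets M. emeasure M A > 0 \<and>
            (AE x in M. x \<in> A \<longrightarrow> limsup (\<lambda>n. ereal (Bq M T q f n x)) < \<infinity>))
          \<longrightarrow> (\<exists>c::ereal. c \<noteq> \<infinity> \<and>
                (AE x in M. (\<lambda>n. ereal (Aplus M T f n x)) \<longlonglongrightarrow> c \<and>
                            (\<lambda>n. ereal (Aminus M T f n x)) \<longlonglongrightarrow> c \<and>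
                            (\<lambda>n. ereal (Bavg M T f n x)) \<longlonglongrightarrow> c \<and>
                            (\<lambda>n. ereal (Bq M T q f n x)) \<longlonglongrightarrow> c)))
       \<and> ((AE x in M. convergent (\<lambda>n. Bavg M T f n x)) \<longleftrightarrow>
          (AE x in M. convergent (\<lambda>n. Bq M T q f n x)))"
proof (intro conjI impI)
  assume "\<exists>A\<in>sets M. emeasure M A > 0 \<and>
    (AE x in M. x \<in> A \<longrightarrow> limsup (\<lambda>n. ereal (Bq M T q f n x)) < \<infinity>)"
  then obtain c :: ereal where c: "c \<noteq> \<infinity>" "AE x in M. (\<lambda>n. ereal (Aplus M T f n x)) \<longlonglongrightarrow> c \<and>
    (\<lambda>n. ereal (Aminus M T f n x)) \<longlonglongrightarrow> c \<and> (\<forall>q. (\<lambda>n. ereal (Bq M T q f n x)) \<longlonglongrightarrow> c)"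
    using AE_limits_if_limsup_finite[OF assms] by blast
  from c(2) have "AE x in M. (\<lambda>n. ereal (Aplus M T f n x)) \<longlonglongrightarrow> c \<and>
    (\<lambda>n. ereal (Aminus M T f n x)) \<longlonglongrightarrow> c \<and> (\<lambda>n. ereal (Bavg M T f n x)) \<longlonglongrightarrow> c \<and>
    (\<lambda>n. ereal (Bq M T q f n x)) \<longlonglongrightarrow> c"
    unfolding Bavg_eq_Bq by eventually_elim blast
  with c(1) show "\<exists>c::ereal. c \<noteq> \<infinity> \<and>
    (AE x in M. (\<lambda>n. ereal (Aplus M T f n x)) \<longlonglongrightarrow> c \<and>
                (\<lambda>n. ereal (Aminus M T f n x)) \<longlonglongrightarrow> c \<and>
                (\<lambda>n. ereal (Bavg M T f n x)) \<longlonglongrightarrow> c \<and>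
                (\<lambda>n. ereal (Bq M T q f n x)) \<longlonglongrightarrow> c)"
    by blast
next
  show "(AE x in M. convergent (\<lambda>n. Bavg M T f n x)) \<longleftrightarrow>
    (AE x in M. convergent (\<lambda>n. Bq M T q f n x))"
    unfolding Bavg_eq_Bq using AE_convergent_Bq[OF assms] by blast
qed

end
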